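(* Let $M$ be a smooth manifold, $\chi\in\Omega^3(M)$ a closed 3-form, and suppose a connected Lie group $G$ with Lie algebra $\mathfrak g$ acts on $M$ preserving $\chi$ and admits a homotopy moment map $\mathsf J_\chi:\mathfrak g\to\mathbb L(M,\chi)$. Let $\tau\in\Omega^2(M)^G$ be a $G$-invariant 2-form and let $\mathsf J_{\chi+d\tau}:\mathfrak g\to\mathbb L(M,\chi+d\tau)$ be the induced homotopy moment map. Suppose $(M,\chi)$ admits a prequantization $S^1$-bundle gerbe with connection, i.e. there are an $S^1$-bundle gerbe over $M$, a connection $\gamma$ on it and a curving for $\gamma$ whose 3-curvature is $\chi$. Then the two compositions of Lie 2-algebra morphisms $$\mathsf T_\tau\circ\mathsf R_\chi\circ\mathsf J_\chi\quad\text{and}\quad \mathsf R_{\chi+d\tau}\circ\mathsf J_{\chi+d\tau}:\ \mathfrak g\longrightarrow\mathbb L(C_{\chi+d\tau})$$ are 2-isomorphic (i.e. the associated butterflies are isomorphic), where $\mathsf R_\chi:\mathbb L(M,\chi)\to\mathbb L(C_\chi)$ and $\mathsf R_{\chi+d\tau}:\mathbb L(M,\chi+d\tau)\to\mathbb L(C_{\chi+d\tau})$ are Rogers' embeddings and $\mathsf T_\tau:\mathbb L(C_\chi)\to\mathbb L(C_{\chi+d\tau})$ is the strict isomorphism $(\mathsf T_\tau)_0(u,\alpha)=(u,\alpha+\iota_u\tau)$, $(\mathsf T_\tau)_1=\mathrm{id}$.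
   Context: **Lie 2-algebras.** A Lie 2-algebra $V$ consists of a linear map $\partial:V_1\to V_0$ of real vector spaces, a skew bilinear bracket $V_0\times V_0\to V_0$, a bilinear bracket $V_0\times V_1\to V_1$ (with $[a,x]:=-[x,a]$), and an alternating trilinear Jacobiator $J:V_0^3\to V_1$, such that $\partial[x,a]=[x,\partial a]$, $[\partial a,b]=[a,\partial b]$, $\partial J(x,y,z)=[x,[y,z]]+[y,[z,x]]+[z,[x,y]]$, $J(x,y,\partial a)=[x,[y,a]]+[y,[a,x]]+[a,[x,y]]$, and $\sum_i(-1)^{i+1}[x_i,J(\dots\widehat{x_i}\dots)]+\sum_{i<j}(-1)^{i+j}J([x_i,x_j],\dots\widehat{x_i}\dots\widehat{x_j}\dots)=0$ for $x_1,\dots,x_4\in V_0$. A Lie algebra $\mathfrak g$ is a Lie 2-algebra with $V_0=\mathfrak g$, $V_1=0$. **Morphisms (sign convention used here).** A morphism $f:V\to W$ is a chain map $(f_0,f_1)$ with a skew bilinear $f_2:V_0\times V_0\to W_1$ such that $\partial f_2(x,y)=[f_0x,f_0y]-f_0[x,y]$, $f_2(x,\partial a)=[f_0x,f_1a]-f_1[x,a]$, and $J_W(f_0x,f_0y,f_0z)-f_1J_V(x,y,z)=\sum_{\rm cyc}\big([f_0x,f_2(y,z)]+f_2(x,[y,z])\big)$. Strict means $f_2=0$. Composition: $(g\circ f)_i=g_if_i$ for $i=0,1$ and $(g\circ f)_2(x,y)=g_1f_2(x,y)+g_2(f_0x,f_0y)$. The butterfly associated to $f$ is the vector space $W_1\oplus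 V_0$ with maps $\kappa(v)=(-f_1(v),\partial v)$ for $v\in V_1$, $\lambda(w)=(w,0)$ for $w\in W_1$, $\sigma(w,x)=x\in V_0$, $\rho(w,x)=\partial w+f_0(x)\in W_0$, and bracket $[(w,x),(w',x')]=([f_0x,w']-[f_0x',w]+[\partial w,w']+f_2(x,x'),[x,x'])$. An isomorphism of butterflies is a bracket-preserving linear isomorphism commuting with the maps $\kappa,\lambda,\sigma,\rho$. **Lie 2-algebras attached to a closed 3-form $\chi$.** $\mathbb L(M,\chi)$: complex $C^\infty(M)\to\{(x,\beta)\in\mathfrak X(M)\times\Omega^1(M):\iota_x\chi=-d\beta\}$, $\mathsf d f=(0,df)$, bracket $[(x_1,\beta_1),(x_2,\beta_2)]=([x_1,x_2],\iota_{x_2}\iota_{x_1}\chi)$ in degree 0 and zero in mixed degree, Jacobiator $-\iota_{x_3}\iota_{x_2}\iota_{x_1}\chi$. $\mathbb L(C_\chi)$: complex $C^\infty(M)\to\Gamma(TM\oplus T^*M)$, $\mathsf d f=(0,df)$, brackets $[(u,\alpha),(v,\beta)]=([u,v],L_u\beta-L_v\alpha-\frac12d(\iota_u\beta-\iota_v\alpha)-\iota_v\iota_u\chi)$ and $[(u,\alpha),f]=\frac12\iota_udf$, Jacobiator $-\frac16(\langle[e_1,e_2],e_3\rangle^++\text{cyc.})$ with $\langle(u,\alpha),(v,\beta)\rangle^+=\iota_u\beta+\iota_v\alpha$. **Rogers' embedding** $\mathsf R_\chi$: inclusion in degree 0, identity in degree 1, and, in the sign convention for morphisms $f$ in which $\partial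 f_2(x,y)=[f_0x,f_0y]-f_0[x,y]$, second component $(\mathsf R_\chi)_2((x,\beta),(z,\varphi))=\frac12(\iota_x\varphi-\iota_z\beta)$. **Homotopy moment maps.** For $\xi\in\mathfrak g$ let $\xi_M$ be the generating vector field, with the convention that $\xi\mapsto\xi_M$ is a Lie algebra homomorphism. A homotopy moment map is a Lie 2-algebra morphism $\mathsf J_\chi:\mathfrak g\to\mathbb L(M,\chi)$ with $(\mathsf J_\chi)_0(\xi)=(\xi_M,\beta_\xi)$ for some $\beta_\xi\in\Omega^1(M)$; write $J_\chi:\mathfrak g\otimes\mathfrak g\to C^\infty(M)$ for its second component $(\mathsf J_\chi)_2$. The induced homotopy moment map is $(\mathsf J_{\chi+d\tau})_0(\xi)=(\mathsf J_\chi)_0(\xi)+(0,\iota_{\xi_M}\tau)$, $J_{\chi+d\tau}(\xi\otimes\zeta)=J_\chi(\xi\otimes\zeta)-\iota_{\xi_M}\iota_{\zeta_M}\tau$. **Bundle gerbes.** An $S^1$-bundle gerbe over $M$ consists of a surjective submersion $\pi:X\to M$, a Lie groupoid $P\rightrightarrows X$ (source $s$, target $t$, multiplication $m$), a Lie groupoid morphism over $\mathrm{id}_X$ from $P$ to $X\times_MX\rightrightarrows X$, and a left $S^1$-action on $P$ making $P\to X\times_MX$ a principal $S^1$-bundle with $(zp)\cdot(wq)=(zw)(p\cdot q)$. A connection is a principal connection 1-form $\gamma\in\Omega^1(P)$ with $m^*\gamma=\mathrm{pr}_1^*\gamma+\mathrm{pr}_2^*\gamma$; a curving is $B\in\Omega^2(X)$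 with $s^*B-t^*B=d\gamma$; the 3-curvature is the $\chi\in\Omega^3(M)$ with $\pi^*\chi=dB$. *)

theory Defs
  imports
    "HOL-Analysis.Analysis"
    "HOL-Library.Function_Algebras"
    "HOL-Algebra.Group_Action"
begin

text \<open>Function_Algebras provides the pointwise ring structure on functions; we add the pointwise
  real scalar multiplication, so that smooth functions, vector fields and differential forms live
  in real vector space types.\<close>

instantiation "fun" :: (type, real_vector) real_vector
begin

definition "scaleR_fun (r::real) (f::'a \<Rightarrow> 'b) = (\<lambda>x. r *\<^sub>R f x)"

instance
  by standard (auto simp: scaleR_fun_def plus_fun_def fun_eq_iff algebra_simps)

end


section \<open>Smooth manifolds\<close>

text \<open>Model space: the library's \<open>Euclidean_space n\<close>, i.e. sequences vanishing from index \<open>n\<close> on,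
  so that dimensions (including 0) are natural numbers rather than types.\<close>

definition partial_deriv :: "nat \<Rightarrow> ((nat \<Rightarrow> real) \<Rightarrow> real) \<Rightarrow> (nat \<Rightarrow> real) \<Rightarrow> real" where
  "partial_deriv i f x = deriv (\<lambda>t. f (x(i := t))) (x i)"

primrec Ck_on :: "nat \<Rightarrow> nat \<Rightarrow> (nat \<Rightarrow> real) set \<Rightarrow> ((nat \<Rightarrow> real) \<Rightarrow> real) \<Rightarrow> bool" where
  "Ck_on 0 n U f \<longleftrightarrow> continuous_map (subtopology (Euclidean_space n) U) euclideanreal f"
| "Ck_on (Suc k) n U f \<longleftrightarrow>
     continuous_map (subtopology (Euclidean_space n) U) euclideanreal f \<and>
     (\<forall>i<n. (\<forall>x\<in>U. (\<lambda>t. f (x(i := t))) differentiable (at (x i))) \<and>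
            Ck_on k n U (partial_deriv i f))"

text \<open>Used only for \<open>U\<close> open in \<open>Euclidean_space n\<close>.\<close>

definition smooth_on :: "nat \<Rightarrow> (nat \<Rightarrow> real) set \<Rightarrow> ((nat \<Rightarrow> real) \<Rightarrow> real) \<Rightarrow> bool" where
  "smooth_on n U f \<longleftrightarrow> (\<forall>k. Ck_on k n U f)"

record 'a manifold =
  mtop :: "'a topology"
  mdim :: nat
  atlas :: "('a set \<times> ('a \<Rightarrow> nat \<Rightarrow> real)) set"

abbreviation pts :: "'a manifold \<Rightarrow> 'a set" where
  "pts M \<equiv> topspace (mtop M)"

definition is_manifold :: "'a manifold \<Rightarrow> bool" where
  "is_manifold M \<longleftrightarrow>
     Hausdorff_space (mtop M) \<and> second_countable (mtop M) \<and>
     pts M = (\<Union>(U, \<phi>)\<in>atlas M. U) \<and>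
     (\<forall>(U, \<phi>)\<in>atlas M. openin (mtop M) U \<and> openin (Euclidean_space (mdim M)) (\<phi> ` U) \<and>
        homeomorphic_map (subtopology (mtop M) U)
          (subtopology (Euclidean_space (mdim M)) (\<phi> ` U)) \<phi>) \<and>
     (\<forall>(U, \<phi>)\<in>atlas M. \<forall>(V, \<psi>)\<in>atlas M. \<forall>i<mdim M.
        smooth_on (mdim M) (\<phi> ` (U \<inter> V)) (\<lambda>x. \<psi> (inv_into U \<phi> x) i))"

definition smooth_map :: "'a manifold \<Rightarrow> 'b manifold \<Rightarrow> ('a \<Rightarrow> 'b) \<Rightarrow> bool" where
  "smooth_map M N F \<longleftrightarrow>
     continuous_map (mtop M) (mtop N) F \<and>
     (\<forall>(U, \<phi>)\<in>atlas M. \<forall>(V, \<psi>)\<in>atlas N. \<forall>i<mdim N.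
        smooth_on (mdim M) (\<phi> ` {p \<in> U. F p \<in> V}) (\<lambda>x. \<psi> (F (inv_into U \<phi> x)) i))"

definition diffeo :: "'a manifold \<Rightarrow> 'b manifold \<Rightarrow> ('a \<Rightarrow> 'b) \<Rightarrow> bool" where
  "diffeo M N F \<longleftrightarrow>
     bij_betw F (pts M) (pts N) \<and> smooth_map M N F \<and> smooth_map N M (inv_into (pts M) F)"

definition prod_manifold :: "'a manifold \<Rightarrow> 'b manifold \<Rightarrow> ('a \<times> 'b) manifold" where
  "prod_manifold M N =
     \<lparr>mtop = prod_topology (mtop M) (mtop N),
      mdim = mdim M + mdim N,
      atlas = {(U \<times> V, \<lambda>(p, q) i. if i < mdim M then \<phi> p i else \<psi> q (i - mdim M)) | U \<phi> V \<psi>.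
                 (U, \<phi>) \<in> atlas M \<and> (V, \<psi>) \<in> atlas N}\<rparr>"

definition open_submanifold :: "'a manifold \<Rightarrow> 'a set \<Rightarrow> 'a manifold" where
  "open_submanifold M W =
     \<lparr>mtop = subtopology (mtop M) W, mdim = mdim M, atlas = {(U \<inter> W, \<phi>) | U \<phi>. (U, \<phi>) \<in> atlas M}\<rparr>"

text \<open>The circle, with the angle functions on the complements of single points as charts.\<close>

definition circle :: "complex manifold" where
  "circle =
     \<lparr>mtop = subtopology euclidean {z. cmod z = 1},
      mdim = 1,
      atlas = {(cis ` {a<..<a + 2 * pi},
                \<lambda>z i. if i = 0 then (THE t. a < t \<and> t < a + 2 * pi \<and> cis t = z) else 0) | a. True}\<rparr>"


section \<open>Functions, tangent vectors, vector fields, differential forms\<close>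

type_synonym 'a fn = "'a \<Rightarrow> real"
type_synonym 'a tvec = "'a fn \<Rightarrow> real"
type_synonym 'a vf = "'a fn \<Rightarrow> 'a fn"
type_synonym 'a form1 = "'a vf \<Rightarrow> 'a fn"
type_synonym 'a form2 = "'a vf \<Rightarrow> 'a form1"
type_synonym 'a form3 = "'a vf \<Rightarrow> 'a form2"
type_synonym 'a form4 = "'a vf \<Rightarrow> 'a form3"

text \<open>All objects are extended by zero outside their domains, so that equality is the
  intended one.\<close>

definition Cinf :: "'a manifold \<Rightarrow> 'a fn set" where
  "Cinf M = {f. (\<forall>p. p \<notin> pts M \<longrightarrow> f p = 0) \<and>
                (\<forall>(U, \<phi>)\<in>atlas M. smooth_on (mdim M) (\<phi> ` U) (\<lambda>x. f (inv_into U \<phi> x)))}"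

definition fn_pullback :: "'a manifold \<Rightarrow> ('a \<Rightarrow> 'b) \<Rightarrow> 'b fn \<Rightarrow> 'a fn" where
  "fn_pullback M F f = (\<lambda>p. if p \<in> pts M then f (F p) else 0)"

definition tangent_space :: "'a manifold \<Rightarrow> 'a \<Rightarrow> 'a tvec set" where
  "tangent_space M p = {v.
     (\<forall>f. f \<notin> Cinf M \<longrightarrow> v f = 0) \<and>
     (\<forall>f\<in>Cinf M. \<forall>g\<in>Cinf M. v (f + g) = v f + v g) \<and>
     (\<forall>c. \<forall>f\<in>Cinf M. v (c *\<^sub>R f) = c * v f) \<and>
     (\<forall>f\<in>Cinf M. \<forall>g\<in>Cinf M. v (f * g) = v f * g p + f p * v g)}"

definition tangent_map ::
    "'a manifold \<Rightarrow> 'b manifold \<Rightarrow> ('a \<Rightarrow> 'b) \<Rightarrow> 'a tvec \<Rightarrow> 'b tvec" where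
  "tangent_map M N F v = (\<lambda>f. if f \<in> Cinf N then v (fn_pullback M F f) else 0)"

text \<open>Vector fields are the derivations of the algebra of smooth functions.\<close>

definition vfields :: "'a manifold \<Rightarrow> 'a vf set" where
  "vfields M = {X.
     (\<forall>f. f \<notin> Cinf M \<longrightarrow> X f = 0) \<and>
     (\<forall>f\<in>Cinf M. X f \<in> Cinf M) \<and>
     (\<forall>f\<in>Cinf M. \<forall>g\<in>Cinf M. X (f + g) = X f + X g) \<and>
     (\<forall>c. \<forall>f\<in>Cinf M. X (c *\<^sub>R f) = c *\<^sub>R X f) \<and>
     (\<forall>f\<in>Cinf M. \<forall>g\<in>Cinf M. X (f * g) = X f * g + f * X g)}"

definition vmul :: "'a fn \<Rightarrow> 'a vf \<Rightarrow> 'a vf" where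
  "vmul f X = (\<lambda>g. f * X g)"

definition vbr :: "'a vf \<Rightarrow> 'a vf \<Rightarrow> 'a vf" where
  "vbr X Y = (\<lambda>f. X (Y f) - Y (X f))"

definition value_at :: "'a vf \<Rightarrow> 'a \<Rightarrow> 'a tvec" where
  "value_at X p = (\<lambda>f. X f p)"

text \<open>Differential forms are the alternating maps on vector fields that are multilinear over the
  smooth functions.  They are curried, so the interior product \<open>\<iota>\<^sub>x \<omega>\<close> is the application \<open>\<omega> x\<close>;
  for instance \<open>\<iota>\<^sub>z \<iota>\<^sub>y \<iota>\<^sub>x \<omega>\<close> is \<open>\<omega> x y z\<close>.\<close>

definition forms1 :: "'a manifold \<Rightarrow> 'a form1 set" where
  "forms1 M = {\<alpha>.
     (\<forall>X. X \<notin> vfields M \<longrightarrow> \<alpha> X = 0) \<and>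
     (\<forall>X\<in>vfields M. \<alpha> X \<in> Cinf M) \<and>
     (\<forall>X\<in>vfields M. \<forall>Y\<in>vfields M. \<alpha> (X + Y) = \<alpha> X + \<alpha> Y) \<and>
     (\<forall>f\<in>Cinf M. \<forall>X\<in>vfields M. \<alpha> (vmul f X) = f * \<alpha> X)}"

definition forms2 :: "'a manifold \<Rightarrow> 'a form2 set" where
  "forms2 M = {\<omega>.
     (\<forall>X. X \<notin> vfields M \<longrightarrow> \<omega> X = 0) \<and>
     (\<forall>X\<in>vfields M. \<omega> X \<in> forms1 M \<and> \<omega> X X = 0) \<and>
     (\<forall>X\<in>vfields M. \<forall>Y\<in>vfields M. \<omega> (X + Y) = \<omega> X + \<omega> Y) \<and>
     (\<forall>f\<in>Cinf M. \<forall>X\<in>vfields M. \<omega> (vmul f X) = (\<lambda>Y. f * \<omega> X Y))}"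

definition forms3 :: "'a manifold \<Rightarrow> 'a form3 set" where
  "forms3 M = {\<omega>.
     (\<forall>X. X \<notin> vfields M \<longrightarrow> \<omega> X = 0) \<and>
     (\<forall>X\<in>vfields M. \<omega> X \<in> forms2 M \<and> \<omega> X X = 0) \<and>
     (\<forall>X\<in>vfields M. \<forall>Y\<in>vfields M. \<omega> (X + Y) = \<omega> X + \<omega> Y) \<and>
     (\<forall>f\<in>Cinf M. \<forall>X\<in>vfields M. \<omega> (vmul f X) = (\<lambda>Y Z. f * \<omega> X Y Z))}"

definition ext_d0 :: "'a manifold \<Rightarrow> 'a fn \<Rightarrow> 'a form1" where
  "ext_d0 M f = (\<lambda>X. if X \<in> vfields M then X f else 0)"

definition ext_d1 :: "'a manifold \<Rightarrow> 'a form1 \<Rightarrow> 'a form2" where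
  "ext_d1 M \<alpha> = (\<lambda>X Y. if X \<in> vfields M \<and> Y \<in> vfields M
     then X (\<alpha> Y) - Y (\<alpha> X) - \<alpha> (vbr X Y) else 0)"

definition ext_d2 :: "'a manifold \<Rightarrow> 'a form2 \<Rightarrow> 'a form3" where
  "ext_d2 M \<omega> = (\<lambda>X Y Z. if X \<in> vfields M \<and> Y \<in> vfields M \<and> Z \<in> vfields M
     then X (\<omega> Y Z) - Y (\<omega> X Z) + Z (\<omega> X Y)
        - \<omega> (vbr X Y) Z + \<omega> (vbr X Z) Y - \<omega> (vbr Y Z) X else 0)"

definition ext_d3 :: "'a manifold \<Rightarrow> 'a form3 \<Rightarrow> 'a form4" where
  "ext_d3 M \<omega> = (\<lambda>W X Y Z.
     if W \<in> vfields M \<and> X \<in> vfields M \<and> Y \<in> vfields M \<and> Z \<in> vfields M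
     then W (\<omega> X Y Z) - X (\<omega> W Y Z) + Y (\<omega> W X Z) - Z (\<omega> W X Y)
        - \<omega> (vbr W X) Y Z + \<omega> (vbr W Y) X Z - \<omega> (vbr W Z) X Y
        - \<omega> (vbr X Y) W Z + \<omega> (vbr X Z) W Y - \<omega> (vbr Y Z) W X else 0)"

definition lie_deriv1 :: "'a manifold \<Rightarrow> 'a vf \<Rightarrow> 'a form1 \<Rightarrow> 'a form1" where
  "lie_deriv1 M X \<alpha> = (\<lambda>Y. if Y \<in> vfields M then X (\<alpha> Y) - \<alpha> (vbr X Y) else 0)"

text \<open>A form is evaluated on tangent vectors at \<open>p\<close> by extending them to vector fields; by
  tensoriality the value does not depend on the chosen extension, and extensions exist by cutting
  off in a chart.\<close>

definition extend_vec :: "'a manifold \<Rightarrow> 'a \<Rightarrow> 'a tvec \<Rightarrow> 'a vf" where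
  "extend_vec M p v = (SOME X. X \<in> vfields M \<and> value_at X p = v)"

definition pullback1 :: "'a manifold \<Rightarrow> 'b manifold \<Rightarrow> ('a \<Rightarrow> 'b) \<Rightarrow> 'b form1 \<Rightarrow> 'a form1" where
  "pullback1 M N F \<omega> = (\<lambda>X p. if X \<in> vfields M \<and> p \<in> pts M
     then (let e = (\<lambda>X. extend_vec N (F p) (tangent_map M N F (value_at X p))) in \<omega> (e X) (F p))
     else 0)"

definition pullback2 :: "'a manifold \<Rightarrow> 'b manifold \<Rightarrow> ('a \<Rightarrow> 'b) \<Rightarrow> 'b form2 \<Rightarrow> 'a form2" where
  "pullback2 M N F \<omega> = (\<lambda>X Y p. if X \<in> vfields M \<and> Y \<in> vfields M \<and> p \<in> pts M
     then (let e = (\<lambda>X. extend_vec N (F p) (tangent_map M N F (value_at X p)))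
           in \<omega> (e X) (e Y) (F p))
     else 0)"

definition pullback3 :: "'a manifold \<Rightarrow> 'b manifold \<Rightarrow> ('a \<Rightarrow> 'b) \<Rightarrow> 'b form3 \<Rightarrow> 'a form3" where
  "pullback3 M N F \<omega> = (\<lambda>X Y Z p.
     if X \<in> vfields M \<and> Y \<in> vfields M \<and> Z \<in> vfields M \<and> p \<in> pts M
     then (let e = (\<lambda>X. extend_vec N (F p) (tangent_map M N F (value_at X p)))
           in \<omega> (e X) (e Y) (e Z) (F p))
     else 0)"

definition surj_submersion :: "'a manifold \<Rightarrow> 'b manifold \<Rightarrow> ('a \<Rightarrow> 'b) \<Rightarrow> bool" where
  "surj_submersion M N F \<longleftrightarrow>
     smooth_map M N F \<and> F ` pts M = pts N \<and>
     (\<forall>p\<in>pts M. tangent_space N (F p) \<subseteq> tangent_map M N F ` tangent_space M p)"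

text \<open>\<open>N\<close> is a manifold with underlying set \<open>S\<close>, embedded in \<open>M\<close>.  Up to equivalence of atlases
  there is at most one such \<open>N\<close>.\<close>

definition embedded_submanifold :: "'a manifold \<Rightarrow> 'a manifold \<Rightarrow> 'a set \<Rightarrow> bool" where
  "embedded_submanifold N M S \<longleftrightarrow>
     is_manifold N \<and> S \<subseteq> pts M \<and> mtop N = subtopology (mtop M) S \<and> smooth_map N M (\<lambda>p. p) \<and>
     (\<forall>p\<in>S. inj_on (tangent_map N M (\<lambda>p. p)) (tangent_space N p))"


section \<open>Lie 2-algebras\<close>

record ('v, 'w) lie2 =
  deg0 :: "'v set"
  deg1 :: "'w set"
  bd :: "'w \<Rightarrow> 'v"
  br :: "'v \<Rightarrow> 'v \<Rightarrow> 'v"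
  mbr :: "'v \<Rightarrow> 'w \<Rightarrow> 'w"
  jac :: "'v \<Rightarrow> 'v \<Rightarrow> 'v \<Rightarrow> 'w"

definition lin_on :: "'a::real_vector set \<Rightarrow> 'b::real_vector set \<Rightarrow> ('a \<Rightarrow> 'b) \<Rightarrow> bool" where
  "lin_on A B f \<longleftrightarrow> f ` A \<subseteq> B \<and>
     (\<forall>x\<in>A. \<forall>y\<in>A. f (x + y) = f x + f y) \<and> (\<forall>c. \<forall>x\<in>A. f (c *\<^sub>R x) = c *\<^sub>R f x)"

definition bilin_on ::
    "'a::real_vector set \<Rightarrow> 'b::real_vector set \<Rightarrow> 'c::real_vector set \<Rightarrow> ('a \<Rightarrow> 'b \<Rightarrow> 'c) \<Rightarrow> bool" where
  "bilin_on A B C f \<longleftrightarrow> (\<forall>x\<in>A. lin_on B C (f x)) \<and> (\<forall>y\<in>B. lin_on A C (\<lambda>x. f x y))"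

definition lie2_algebra :: "('v::real_vector, 'w::real_vector) lie2 \<Rightarrow> bool" where
  "lie2_algebra V \<longleftrightarrow>
     subspace (deg0 V) \<and> subspace (deg1 V) \<and>
     lin_on (deg1 V) (deg0 V) (bd V) \<and>
     bilin_on (deg0 V) (deg0 V) (deg0 V) (br V) \<and>
     (\<forall>x\<in>deg0 V. \<forall>y\<in>deg0 V. br V x y = - br V y x) \<and>
     bilin_on (deg0 V) (deg1 V) (deg1 V) (mbr V) \<and>
     (\<forall>x\<in>deg0 V. bilin_on (deg0 V) (deg0 V) (deg1 V) (jac V x)) \<and>
     (\<forall>y\<in>deg0 V. \<forall>z\<in>deg0 V. lin_on (deg0 V) (deg1 V) (\<lambda>x. jac V x y z)) \<and>
     (\<forall>x\<in>deg0 V. \<forall>y\<in>deg0 V. jac V x x y = 0 \<and> jac V x y y = 0 \<and> jac V x y x = 0) \<and>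
     (\<forall>x\<in>deg0 V. \<forall>a\<in>deg1 V. bd V (mbr V x a) = br V x (bd V a)) \<and>
     (\<forall>a\<in>deg1 V. \<forall>b\<in>deg1 V. mbr V (bd V a) b = - mbr V (bd V b) a) \<and>
     (\<forall>x\<in>deg0 V. \<forall>y\<in>deg0 V. \<forall>z\<in>deg0 V.
        bd V (jac V x y z) = br V x (br V y z) + br V y (br V z x) + br V z (br V x y)) \<and>
     (\<forall>x\<in>deg0 V. \<forall>y\<in>deg0 V. \<forall>a\<in>deg1 V.
        jac V x y (bd V a) = mbr V x (mbr V y a) + mbr V y (- mbr V x a) + (- mbr V (br V x y) a)) \<and>
     (\<forall>x\<in>deg0 V. \<forall>y\<in>deg0 V. \<forall>z\<in>deg0 V. \<forall>w\<in>deg0 V.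
        mbr V x (jac V y z w) - mbr V y (jac V x z w) + mbr V z (jac V x y w) - mbr V w (jac V x y z)
        - jac V (br V x y) z w + jac V (br V x z) y w - jac V (br V x w) y z
        - jac V (br V y z) x w + jac V (br V y w) x z - jac V (br V z w) x y = 0)"

record ('v, 'w, 'v', 'w') lie2_mor =
  mor0 :: "'v \<Rightarrow> 'v'"
  mor1 :: "'w \<Rightarrow> 'w'"
  mor2 :: "'v \<Rightarrow> 'v \<Rightarrow> 'w'"

definition lie2_morphism ::
    "('v::real_vector, 'w::real_vector) lie2 \<Rightarrow> ('v'::real_vector, 'w'::real_vector) lie2 \<Rightarrow>
     ('v, 'w, 'v', 'w') lie2_mor \<Rightarrow> bool" where
  "lie2_morphism V W f \<longleftrightarrow>
     lie2_algebra V \<and> lie2_algebra W \<and>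
     lin_on (deg0 V) (deg0 W) (mor0 f) \<and> lin_on (deg1 V) (deg1 W) (mor1 f) \<and>
     (\<forall>a\<in>deg1 V. bd W (mor1 f a) = mor0 f (bd V a)) \<and>
     bilin_on (deg0 V) (deg0 V) (deg1 W) (mor2 f) \<and>
     (\<forall>x\<in>deg0 V. \<forall>y\<in>deg0 V. mor2 f x y = - mor2 f y x) \<and>
     (\<forall>x\<in>deg0 V. \<forall>y\<in>deg0 V.
        bd W (mor2 f x y) = br W (mor0 f x) (mor0 f y) - mor0 f (br V x y)) \<and>
     (\<forall>x\<in>deg0 V. \<forall>a\<in>deg1 V.
        mor2 f x (bd V a) = mbr W (mor0 f x) (mor1 f a) - mor1 f (mbr V x a)) \<and>
     (\<forall>x\<in>deg0 V. \<forall>y\<in>deg0 V. \<forall>z\<in>deg0 V.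
        jac W (mor0 f x) (mor0 f y) (mor0 f z) - mor1 f (jac V x y z) =
          (mbr W (mor0 f x) (mor2 f y z) + mor2 f x (br V y z)) +
          (mbr W (mor0 f y) (mor2 f z x) + mor2 f y (br V z x)) +
          (mbr W (mor0 f z) (mor2 f x y) + mor2 f z (br V x y)))"

definition lie2_comp ::
    "('b, 'b1, 'c, 'c1::real_vector) lie2_mor \<Rightarrow> ('a, 'a1, 'b, 'b1) lie2_mor \<Rightarrow>
     ('a, 'a1, 'c, 'c1) lie2_mor" where
  "lie2_comp g f =
     \<lparr>mor0 = mor0 g \<circ> mor0 f, mor1 = mor1 g \<circ> mor1 f,
      mor2 = (\<lambda>x y. mor1 g (mor2 f x y) + mor2 g (mor0 f x) (mor0 f y))\<rparr>"

record ('v, 'w, 'v', 'w', 'e) butterfly =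
  total :: "'e set"
  kap :: "'w \<Rightarrow> 'e"
  lam :: "'w' \<Rightarrow> 'e"
  sig :: "'e \<Rightarrow> 'v"
  rho :: "'e \<Rightarrow> 'v'"
  ebr :: "'e \<Rightarrow> 'e \<Rightarrow> 'e"

definition butterfly_of ::
    "('v::real_vector, 'w::real_vector) lie2 \<Rightarrow> ('v'::real_vector, 'w'::real_vector) lie2 \<Rightarrow>
     ('v, 'w, 'v', 'w') lie2_mor \<Rightarrow> ('v, 'w, 'v', 'w', 'w' \<times> 'v) butterfly" where
  "butterfly_of V W f =
     \<lparr>total = deg1 W \<times> deg0 V,
      kap = (\<lambda>v. (- mor1 f v, bd V v)),
      lam = (\<lambda>w. (w, 0)),
      sig = (\<lambda>(w, x). x),
      rho = (\<lambda>(w, x). bd W w + mor0 f x),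
      ebr = (\<lambda>(w, x) (w', x').
        (mbr W (mor0 f x) w' - mbr W (mor0 f x') w + mbr W (bd W w) w' + mor2 f x x', br V x x'))\<rparr>"

definition butterfly_iso ::
    "('v::real_vector, 'w::real_vector) lie2 \<Rightarrow> ('v'::real_vector, 'w'::real_vector) lie2 \<Rightarrow>
     ('v, 'w, 'v', 'w', 'e::real_vector) butterfly \<Rightarrow> ('v, 'w, 'v', 'w', 'e'::real_vector) butterfly \<Rightarrow>
     ('e \<Rightarrow> 'e') \<Rightarrow> bool" where
  "butterfly_iso V W E E' \<Phi> \<longleftrightarrow>
     lin_on (total E) (total E') \<Phi> \<and> bij_betw \<Phi> (total E) (total E') \<and>
     (\<forall>a\<in>total E. \<forall>b\<in>total E. \<Phi> (ebr E a b) = ebr E' (\<Phi> a) (\<Phi> b)) \<and>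
     (\<forall>v\<in>deg1 V. \<Phi> (kap E v) = kap E' v) \<and>
     (\<forall>w\<in>deg1 W. \<Phi> (lam E w) = lam E' w) \<and>
     (\<forall>a\<in>total E. sig E' (\<Phi> a) = sig E a) \<and>
     (\<forall>a\<in>total E. rho E' (\<Phi> a) = rho E a)"

definition two_isomorphic ::
    "('v::real_vector, 'w::real_vector) lie2 \<Rightarrow> ('v'::real_vector, 'w'::real_vector) lie2 \<Rightarrow>
     ('v, 'w, 'v', 'w') lie2_mor \<Rightarrow> ('v, 'w, 'v', 'w') lie2_mor \<Rightarrow> bool" where
  "two_isomorphic V W f g \<longleftrightarrow>
     lie2_morphism V W f \<and> lie2_morphism V W g \<and>
     (\<exists>\<Phi>. butterfly_iso V W (butterfly_of V W f) (butterfly_of V W g) \<Phi>)"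

text \<open>For a Lie algebra, the degree 1 part is the zero subspace of \<open>real\<close>.\<close>

definition lie2_of_lie_algebra :: "'v set \<Rightarrow> ('v::real_vector \<Rightarrow> 'v \<Rightarrow> 'v) \<Rightarrow> ('v, real) lie2" where
  "lie2_of_lie_algebra \<g> b =
     \<lparr>deg0 = \<g>, deg1 = {0}, bd = (\<lambda>_. 0), br = b, mbr = (\<lambda>_ _. 0), jac = (\<lambda>_ _ _. 0)\<rparr>"


section \<open>The Lie 2-algebras of a closed 3-form\<close>

definition L_form :: "'a manifold \<Rightarrow> 'a form3 \<Rightarrow> ('a vf \<times> 'a form1, 'a fn) lie2" where
  "L_form M \<omega> =
     \<lparr>deg0 = {(x, \<beta>). x \<in> vfields M \<and> \<beta> \<in> forms1 M \<and> \<omega> x = - ext_d1 M \<beta>},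
      deg1 = Cinf M,
      bd = (\<lambda>f. (0, ext_d0 M f)),
      br = (\<lambda>(x1, \<beta>1) (x2, \<beta>2). (vbr x1 x2, \<omega> x1 x2)),
      mbr = (\<lambda>_ _. 0),
      jac = (\<lambda>(x1, \<beta>1) (x2, \<beta>2) (x3, \<beta>3). - \<omega> x1 x2 x3)\<rparr>"

definition courant_br ::
    "'a manifold \<Rightarrow> 'a form3 \<Rightarrow> 'a vf \<times> 'a form1 \<Rightarrow> 'a vf \<times> 'a form1 \<Rightarrow> 'a vf \<times> 'a form1" where
  "courant_br M \<omega> = (\<lambda>(u, \<alpha>) (v, \<beta>).
     (vbr u v, lie_deriv1 M u \<beta> - lie_deriv1 M v \<alpha> - (1/2) *\<^sub>R ext_d0 M (\<beta> u - \<alpha> v) - \<omega> u v))"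

definition pairing :: "'a vf \<times> 'a form1 \<Rightarrow> 'a vf \<times> 'a form1 \<Rightarrow> 'a fn" where
  "pairing = (\<lambda>(u, \<alpha>) (v, \<beta>). \<beta> u + \<alpha> v)"

definition L_courant :: "'a manifold \<Rightarrow> 'a form3 \<Rightarrow> ('a vf \<times> 'a form1, 'a fn) lie2" where
  "L_courant M \<omega> =
     \<lparr>deg0 = vfields M \<times> forms1 M,
      deg1 = Cinf M,
      bd = (\<lambda>f. (0, ext_d0 M f)),
      br = courant_br M \<omega>,
      mbr = (\<lambda>(u, \<alpha>) f. (1/2) *\<^sub>R ext_d0 M f u),
      jac = (\<lambda>e1 e2 e3. - (1/6) *\<^sub>R
        (pairing (courant_br M \<omega> e1 e2) e3 + pairing (courant_br M \<omega> e2 e3) e1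
          + pairing (courant_br M \<omega> e3 e1) e2))\<rparr>"

type_synonym 'a lie2_endo =
  "('a vf \<times> 'a form1, 'a fn, 'a vf \<times> 'a form1, 'a fn) lie2_mor"

text \<open>The formula for Rogers' embedding does not involve \<open>\<omega>\<close>; only its source and target do.\<close>

definition rogers :: "'a lie2_endo" where
  "rogers =
     \<lparr>mor0 = (\<lambda>e. e), mor1 = (\<lambda>f. f),
      mor2 = (\<lambda>(x, \<beta>) (z, \<phi>). (1/2) *\<^sub>R (\<phi> x - \<beta> z))\<rparr>"

definition T_iso :: "'a form2 \<Rightarrow> 'a lie2_endo" where
  "T_iso \<tau> = \<lparr>mor0 = (\<lambda>(u, \<alpha>). (u, \<alpha> + \<tau> u)), mor1 = (\<lambda>f. f), mor2 = (\<lambda>_ _. 0)\<rparr>"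


section \<open>Lie group actions and homotopy moment maps\<close>

definition lie_group :: "('g, 'z) monoid_scheme \<Rightarrow> 'g manifold \<Rightarrow> bool" where
  "lie_group G N \<longleftrightarrow>
     group G \<and> is_manifold N \<and> pts N = carrier G \<and>
     smooth_map (prod_manifold N N) N (\<lambda>(g, h). g \<otimes>\<^bsub>G\<^esub> h) \<and>
     smooth_map N N (\<lambda>g. inv\<^bsub>G\<^esub> g)"

definition left_inv_vfields :: "('g, 'z) monoid_scheme \<Rightarrow> 'g manifold \<Rightarrow> 'g vf set" where
  "left_inv_vfields G N = {\<xi> \<in> vfields N. \<forall>g\<in>carrier G. \<forall>f\<in>Cinf N.
     \<xi> (fn_pullback N (\<lambda>h. g \<otimes>\<^bsub>G\<^esub> h) f) = fn_pullback N (\<lambda>h. g \<otimes>\<^bsub>G\<^esub> h) (\<xi> f)}"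

definition lie_alg :: "('g, 'z) monoid_scheme \<Rightarrow> 'g manifold \<Rightarrow> ('g vf, real) lie2" where
  "lie_alg G N = lie2_of_lie_algebra (left_inv_vfields G N) vbr"

definition smooth_action ::
    "('g, 'z) monoid_scheme \<Rightarrow> 'g manifold \<Rightarrow> 'm manifold \<Rightarrow> ('g \<Rightarrow> 'm \<Rightarrow> 'm) \<Rightarrow> bool" where
  "smooth_action G N M act \<longleftrightarrow>
     group_action G (pts M) act \<and> smooth_map (prod_manifold N M) M (\<lambda>(g, p). act g p)"

text \<open>The value of the generating vector field at \<open>p\<close> is minus the image of \<open>\<xi>\<close> at the unit
  under \<open>g \<mapsto> g p\<close>, i.e. the velocity at time 0 of \<open>exp(-t\<xi>) p\<close>.  With left invariant vector
  fields and a left action, this sign makes \<open>\<xi> \<mapsto> \<xi>\<^sub>M\<close> a homomorphism.\<close>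

definition gen_field ::
    "('g, 'z) monoid_scheme \<Rightarrow> 'g manifold \<Rightarrow> 'm manifold \<Rightarrow> ('g \<Rightarrow> 'm \<Rightarrow> 'm) \<Rightarrow> 'g vf \<Rightarrow> 'm vf" where
  "gen_field G N M act \<xi> = (\<lambda>f p. if f \<in> Cinf M \<and> p \<in> pts M
     then - \<xi> (fn_pullback N (\<lambda>g. act g p) f) \<one>\<^bsub>G\<^esub> else 0)"

type_synonym ('g, 'm) moment_data = "('g vf, real, 'm vf \<times> 'm form1, 'm fn) lie2_mor"

definition homotopy_moment_map ::
    "('g, 'z) monoid_scheme \<Rightarrow> 'g manifold \<Rightarrow> 'm manifold \<Rightarrow> ('g \<Rightarrow> 'm \<Rightarrow> 'm) \<Rightarrow> 'm form3 \<Rightarrow>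
     ('g, 'm) moment_data \<Rightarrow> bool" where
  "homotopy_moment_map G N M act \<omega> J \<longleftrightarrow>
     lie2_morphism (lie_alg G N) (L_form M \<omega>) J \<and>
     (\<forall>\<xi>\<in>left_inv_vfields G N. fst (mor0 J \<xi>) = gen_field G N M act \<xi>)"

definition induced_moment ::
    "('g, 'z) monoid_scheme \<Rightarrow> 'g manifold \<Rightarrow> 'm manifold \<Rightarrow> ('g \<Rightarrow> 'm \<Rightarrow> 'm) \<Rightarrow> 'm form2 \<Rightarrow>
     ('g, 'm) moment_data \<Rightarrow> ('g, 'm) moment_data" where
  "induced_moment G N M act \<tau> J =
     \<lparr>mor0 = (\<lambda>\<xi>. mor0 J \<xi> + (0, \<tau> (gen_field G N M act \<xi>))),
      mor1 = mor1 J,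
      mor2 = (\<lambda>\<xi> \<zeta>. mor2 J \<xi> \<zeta> - \<tau> (gen_field G N M act \<zeta>) (gen_field G N M act \<xi>))\<rparr>"


section \<open>Bundle gerbes\<close>

record ('p, 'x) groupoid =
  arrows :: "'p manifold"
  objects :: "'x manifold"
  src :: "'p \<Rightarrow> 'x"
  tgt :: "'p \<Rightarrow> 'x"
  gmul :: "'p \<Rightarrow> 'p \<Rightarrow> 'p"
  gunit :: "'x \<Rightarrow> 'p"
  ginv :: "'p \<Rightarrow> 'p"

text \<open>\<open>gmul A p q\<close> is meaningful when \<open>src A p = tgt A q\<close>.\<close>

definition composable :: "('p, 'x) groupoid \<Rightarrow> ('p \<times> 'p) set" where
  "composable A = {(p, q). p \<in> pts (arrows A) \<and> q \<in> pts (arrows A) \<and> src A p = tgt A q}"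

definition composable_manifold :: "('p, 'x) groupoid \<Rightarrow> ('p \<times> 'p) manifold \<Rightarrow> bool" where
  "composable_manifold A Q \<longleftrightarrow>
     embedded_submanifold Q (prod_manifold (arrows A) (arrows A)) (composable A)"

definition lie_groupoid :: "('p, 'x) groupoid \<Rightarrow> bool" where
  "lie_groupoid A \<longleftrightarrow>
     is_manifold (arrows A) \<and> is_manifold (objects A) \<and>
     surj_submersion (arrows A) (objects A) (src A) \<and>
     surj_submersion (arrows A) (objects A) (tgt A) \<and>
     smooth_map (objects A) (arrows A) (gunit A) \<and>
     smooth_map (arrows A) (arrows A) (ginv A) \<and>
     (\<exists>Q. composable_manifold A Q \<and> smooth_map Q (arrows A) (\<lambda>(p, q). gmul A p q)) \<and>
     (\<forall>(p, q)\<in>composable A. src A (gmul A p q) = src A q \<and> tgt A (gmul A p q) = tgt A p) \<and>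
     (\<forall>p q r. (p, q) \<in> composable A \<and> (q, r) \<in> composable A \<longrightarrow>
        gmul A (gmul A p q) r = gmul A p (gmul A q r)) \<and>
     (\<forall>x\<in>pts (objects A). src A (gunit A x) = x \<and> tgt A (gunit A x) = x) \<and>
     (\<forall>p\<in>pts (arrows A).
        gmul A (gunit A (tgt A p)) p = p \<and> gmul A p (gunit A (src A p)) = p \<and>
        src A (ginv A p) = tgt A p \<and> tgt A (ginv A p) = src A p \<and>
        gmul A p (ginv A p) = gunit A (tgt A p) \<and> gmul A (ginv A p) p = gunit A (src A p))"

definition groupoid_morphism_over_id ::
    "('p, 'x) groupoid \<Rightarrow> ('q, 'x) groupoid \<Rightarrow> ('p \<Rightarrow> 'q) \<Rightarrow> bool" where
  "groupoid_morphism_over_id A B F \<longleftrightarrow>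
     objects A = objects B \<and> smooth_map (arrows A) (arrows B) F \<and>
     (\<forall>p\<in>pts (arrows A). src B (F p) = src A p \<and> tgt B (F p) = tgt A p) \<and>
     (\<forall>(p, q)\<in>composable A. F (gmul A p q) = gmul B (F p) (F q)) \<and>
     (\<forall>x\<in>pts (objects A). F (gunit A x) = gunit B x)"

definition fibre_pairs :: "'x manifold \<Rightarrow> ('x \<Rightarrow> 'm) \<Rightarrow> ('x \<times> 'x) set" where
  "fibre_pairs X \<pi> = {(x, y). x \<in> pts X \<and> y \<in> pts X \<and> \<pi> x = \<pi> y}"

definition fibre_groupoid :: "'x manifold \<Rightarrow> ('x \<times> 'x) manifold \<Rightarrow> ('x \<times> 'x, 'x) groupoid" where
  "fibre_groupoid X W =
     \<lparr>arrows = W, objects = X, src = snd, tgt = fst,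
      gmul = (\<lambda>p q. (fst p, snd q)), gunit = (\<lambda>x. (x, x)), ginv = (\<lambda>(x, y). (y, x))\<rparr>"

definition circle_action :: "'p manifold \<Rightarrow> (complex \<Rightarrow> 'p \<Rightarrow> 'p) \<Rightarrow> bool" where
  "circle_action P act \<longleftrightarrow>
     smooth_map (prod_manifold circle P) P (\<lambda>(z, p). act z p) \<and>
     (\<forall>p\<in>pts P. act 1 p = p \<and>
        (\<forall>z\<in>pts circle. \<forall>w\<in>pts circle. act (z * w) p = act z (act w p)))"

definition principal_circle_bundle ::
    "'p manifold \<Rightarrow> 'b manifold \<Rightarrow> ('p \<Rightarrow> 'b) \<Rightarrow> (complex \<Rightarrow> 'p \<Rightarrow> 'p) \<Rightarrow> bool" where
  "principal_circle_bundle P W F act \<longleftrightarrow>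
     is_manifold P \<and> is_manifold W \<and> smooth_map P W F \<and> circle_action P act \<and>
     (\<forall>b\<in>pts W. \<exists>U \<Theta>. openin (mtop W) U \<and> b \<in> U \<and>
        diffeo (open_submanifold P {p \<in> pts P. F p \<in> U})
               (prod_manifold circle (open_submanifold W U)) \<Theta> \<and>
        (\<forall>p\<in>pts P. F p \<in> U \<longrightarrow> snd (\<Theta> p) = F p \<and>
           (\<forall>z\<in>pts circle. \<Theta> (act z p) = (z * fst (\<Theta> p), F p))))"

record ('p, 'x, 'm) gerbe =
  grpd :: "('p, 'x) groupoid"
  proj :: "'x \<Rightarrow> 'm"
  pair_mfd :: "('x \<times> 'x) manifold"
  anchor :: "'p \<Rightarrow> 'x \<times> 'x"
  zact :: "complex \<Rightarrow> 'p \<Rightarrow> 'p"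

definition bundle_gerbe :: "'m manifold \<Rightarrow> ('p, 'x, 'm) gerbe \<Rightarrow> bool" where
  "bundle_gerbe M A \<longleftrightarrow>
     lie_groupoid (grpd A) \<and>
     surj_submersion (objects (grpd A)) M (proj A) \<and>
     embedded_submanifold (pair_mfd A)
       (prod_manifold (objects (grpd A)) (objects (grpd A)))
       (fibre_pairs (objects (grpd A)) (proj A)) \<and>
     groupoid_morphism_over_id (grpd A) (fibre_groupoid (objects (grpd A)) (pair_mfd A)) (anchor A) \<and>
     principal_circle_bundle (arrows (grpd A)) (pair_mfd A) (anchor A) (zact A) \<and>
     (\<forall>(p, q)\<in>composable (grpd A). \<forall>z\<in>pts circle. \<forall>w\<in>pts circle.
        gmul (grpd A) (zact A z p) (zact A w q) = zact A (z * w) (gmul (grpd A) p q))"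

text \<open>The Lie algebra of the circle is identified with \<open>\<real>\<close> through \<open>t \<mapsto> cis t\<close>, so a principal
  connection is a real-valued invariant 1-form that takes the value 1 on the velocity of
  \<open>t \<mapsto> cis t \<cdot> p\<close>.\<close>

definition circle_generator ::
    "'p manifold \<Rightarrow> (complex \<Rightarrow> 'p \<Rightarrow> 'p) \<Rightarrow> 'p vf" where
  "circle_generator P act = (\<lambda>f p. if f \<in> Cinf P \<and> p \<in> pts P
     then deriv (\<lambda>t. f (act (cis t) p)) 0 else 0)"

definition principal_connection ::
    "'p manifold \<Rightarrow> (complex \<Rightarrow> 'p \<Rightarrow> 'p) \<Rightarrow> 'p form1 \<Rightarrow> bool" where
  "principal_connection P act \<gamma> \<longleftrightarrow>
     \<gamma> \<in> forms1 P \<and>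
     (\<forall>z\<in>pts circle. pullback1 P P (act z) \<gamma> = \<gamma>) \<and>
     (\<forall>p\<in>pts P. \<gamma> (circle_generator P act) p = 1)"

definition gerbe_connection :: "('p, 'x, 'm) gerbe \<Rightarrow> 'p form1 \<Rightarrow> bool" where
  "gerbe_connection A \<gamma> \<longleftrightarrow>
     principal_connection (arrows (grpd A)) (zact A) \<gamma> \<and>
     (\<exists>Q. composable_manifold (grpd A) Q \<and>
        pullback1 Q (arrows (grpd A)) (\<lambda>(p, q). gmul (grpd A) p q) \<gamma> =
        pullback1 Q (arrows (grpd A)) fst \<gamma> + pullback1 Q (arrows (grpd A)) snd \<gamma>)"

definition gerbe_curving :: "('p, 'x, 'm) gerbe \<Rightarrow> 'p form1 \<Rightarrow> 'x form2 \<Rightarrow> bool" where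
  "gerbe_curving A \<gamma> B \<longleftrightarrow>
     B \<in> forms2 (objects (grpd A)) \<and>
     pullback2 (arrows (grpd A)) (objects (grpd A)) (src (grpd A)) B
       - pullback2 (arrows (grpd A)) (objects (grpd A)) (tgt (grpd A)) B
     = ext_d1 (arrows (grpd A)) \<gamma>"

definition three_curvature :: "'m manifold \<Rightarrow> ('p, 'x, 'm) gerbe \<Rightarrow> 'x form2 \<Rightarrow> 'm form3 \<Rightarrow> bool" where
  "three_curvature M A B \<omega> \<longleftrightarrow>
     \<omega> \<in> forms3 M \<and>
     pullback3 (objects (grpd A)) M (proj A) \<omega> = ext_d2 (objects (grpd A)) B"

end

(* Both compositions have the same components. In degree 0 they send xi to (xi_M, beta + tau xi_M). In
   the second component, the term - tau z x by which the induced moment map is shifted (x and z being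
   the generating vector fields of the two arguments) cancels against (tau z x - tau x z) / 2, the
   change that the new 1-forms cause in Rogers' formula. So the identity map is an isomorphism of the
   two butterflies. What remains is that these maps are morphisms of Lie 2-algebras at all: the first
   composite is one because the moment map, Rogers' embedding and the gauge transformation by tau are, and this rests on the
   Jacobiator and coherence identities of the Courant bracket twisted by a closed 3-form. Since vector
   fields are derivations and forms are alternating multilinear maps, these identities are verified by
   evaluating both sides on vector fields at a point, where they become linear identities over
   the reals. *)
theory Submission
  imports Defs
begin

section \<open>Lie 2-algebras\<close>

text \<open>The induced moment map is never shown to be a morphism by itself: the second composite
  agrees with the first on the carriers and inherits its morphism axioms. That
  \<open>L_form M \<omega>\<close> is a Lie 2-algebra also needs no computation, because
  \<open>lie2_morphism\<close> contains this statement about its target and the moment map is such a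
  morphism. The obstacle is the size of the Courant identities, which mix nested brackets with
  iterated derivatives. They become linear arithmetic only once terms that are equal for a
  mathematical reason are also syntactically equal. Each reason is therefore stated as a rewrite
  rule and instantiated at the vector fields at hand: skew-symmetry sorts arguments, the Jacobi
  identity expresses one of three nested brackets by the other two, and closedness is solved for one
  of the four derivatives. In the Jacobiator identity and in the coherence identity the terms with
  \<open>\<omega>\<close> collect, up to sign, to its exterior derivative at four fields, and this
  is where closedness enters. The target twist must be closed too, hence the proof that the exterior
  derivative squares to zero on 2-forms.\<close>

lemma
  assumes "lin_on A B f" "subspace A"
  shows lin_on_0: "f 0 = 0"
    and lin_on_minus: "x \<in> A \<Longrightarrow> f (- x) = - f x"
    and lin_on_diff: "x \<in> A \<Longrightarrow> y \<in> A \<Longrightarrow> f (x - y) = f x - f y"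
proof -
  have s: "f (c *\<^sub>R x) = c *\<^sub>R f x" if "x \<in> A" for c x
    using assms that by (auto simp: lin_on_def)
  show "f 0 = 0"
    using s[of 0 0] subspace_0[OF assms(2)] by simp
  show m: "f (- x) = - f x" if "x \<in> A" for x
    using s[of x "-1"] that by simp
  show "f (x - y) = f x - f y" if "x \<in> A" "y \<in> A"
    using assms m[of y] that subspace_neg[OF assms(2), of y]
    unfolding lin_on_def by (metis (no_types) diff_conv_add_uminus)
qed

lemma lin_onD:
  assumes "lin_on A B f"
  shows "x \<in> A \<Longrightarrow> f x \<in> B"
    and "x \<in> A \<Longrightarrow> y \<in> A \<Longrightarrow> f (x + y) = f x + f y"
    and "x \<in> A \<Longrightarrow> f (c *\<^sub>R x) = c *\<^sub>R f x"
  using assms by (auto simp: lin_on_def)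

lemma lin_onI:
  assumes "\<And>x. x \<in> A \<Longrightarrow> f x \<in> B" "\<And>x y. x \<in> A \<Longrightarrow> y \<in> A \<Longrightarrow> f (x + y) = f x + f y"
    and "\<And>c x. x \<in> A \<Longrightarrow> f (c *\<^sub>R x) = c *\<^sub>R f x"
  shows "lin_on A B f"
  using assms by (auto simp: lin_on_def)

lemma lin_on_id: "lin_on A A (\<lambda>x. x)"
  by (simp add: lin_on_def)

lemma lin_on_subset: "A \<subseteq> A' \<Longrightarrow> lin_on A' B f \<Longrightarrow> lin_on A B f"
  unfolding lin_on_def by blast

lemma lin_on_uminus: "subspace B \<Longrightarrow> lin_on A B f \<Longrightarrow> lin_on A B (\<lambda>x. - f x)"
  by (auto simp: lin_on_def image_subset_iff subspace_neg)

lemma lin_on_comp: "lin_on B C g \<Longrightarrow> lin_on A B f \<Longrightarrow> lin_on A C (\<lambda>x. g (f x))"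
  by (auto simp: lin_on_def image_subset_iff)

lemma lin_on_add:
  "subspace B \<Longrightarrow> lin_on A B f \<Longrightarrow> lin_on A B g \<Longrightarrow> lin_on A B (\<lambda>x. f x + g x)"
  by (auto simp: lin_on_def image_subset_iff algebra_simps subspace_add)

lemma lin_on_zero: "subspace B \<Longrightarrow> lin_on A B (\<lambda>_. 0)"
  by (auto simp: lin_on_def subspace_0)

lemma bilin_onD:
  assumes "bilin_on A B C f"
  shows "x \<in> A \<Longrightarrow> lin_on B C (f x)"
    and "y \<in> B \<Longrightarrow> lin_on A C (\<lambda>x. f x y)"
    and "x \<in> A \<Longrightarrow> y \<in> B \<Longrightarrow> f x y \<in> C"
  using assms by (auto simp: bilin_on_def dest: lin_onD(1))

section \<open>Morphisms of Lie 2-algebras and their composition\<close>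

lemma lie2_algebraD:
  assumes "lie2_algebra V"
  shows "subspace (deg0 V)" "subspace (deg1 V)" "lin_on (deg1 V) (deg0 V) (bd V)"
    and "x \<in> deg0 V \<Longrightarrow> y \<in> deg0 V \<Longrightarrow> br V x y \<in> deg0 V"
    and "x \<in> deg0 V \<Longrightarrow> lin_on (deg1 V) (deg1 V) (mbr V x)"
    and "x \<in> deg0 V \<Longrightarrow> a \<in> deg1 V \<Longrightarrow> mbr V x a \<in> deg1 V"
    and "x \<in> deg0 V \<Longrightarrow> y \<in> deg0 V \<Longrightarrow> z \<in> deg0 V \<Longrightarrow> jac V x y z \<in> deg1 V"
proof -
  have V: "subspace (deg0 V)" "subspace (deg1 V)" "lin_on (deg1 V) (deg0 V) (bd V)"
    "bilin_on (deg0 V) (deg0 V) (deg0 V) (br V)" "bilin_on (deg0 V) (deg1 V) (deg1 V) (mbr V)"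
    "\<forall>x\<in>deg0 V. bilin_on (deg0 V) (deg0 V) (deg1 V) (jac V x)"
    using assms unfolding lie2_algebra_def by blast+
  show "subspace (deg0 V)" "subspace (deg1 V)" "lin_on (deg1 V) (deg0 V) (bd V)"
    by (fact V)+
  show "x \<in> deg0 V \<Longrightarrow> lin_on (deg1 V) (deg1 V) (mbr V x)"
    by (rule bilin_onD[OF V(5)])
  show "x \<in> deg0 V \<Longrightarrow> a \<in> deg1 V \<Longrightarrow> mbr V x a \<in> deg1 V"
    by (rule bilin_onD[OF V(5)])
  show "x \<in> deg0 V \<Longrightarrow> y \<in> deg0 V \<Longrightarrow> br V x y \<in> deg0 V"
    by (rule bilin_onD[OF V(4)])
  show "x \<in> deg0 V \<Longrightarrow> y \<in> deg0 V \<Longrightarrow> z \<in> deg0 V \<Longrightarrow> jac V x y z \<in> deg1 V"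
    by (rule bilin_onD[OF bspec[OF V(6)]])
qed

lemma lie2_morphismD:
  assumes "lie2_morphism V W f"
  shows "lie2_algebra V" "lie2_algebra W"
    "lin_on (deg0 V) (deg0 W) (mor0 f)" "lin_on (deg1 V) (deg1 W) (mor1 f)"
    "a \<in> deg1 V \<Longrightarrow> bd W (mor1 f a) = mor0 f (bd V a)"
    "x \<in> deg0 V \<Longrightarrow> lin_on (deg0 V) (deg1 W) (mor2 f x)"
    "x \<in> deg0 V \<Longrightarrow> lin_on (deg0 V) (deg1 W) (\<lambda>y. mor2 f y x)"
    "x \<in> deg0 V \<Longrightarrow> y \<in> deg0 V \<Longrightarrow> mor2 f x y = - mor2 f y x"
    "x \<in> deg0 V \<Longrightarrow> y \<in> deg0 V \<Longrightarrow>
      bd W (mor2 f x y) = br W (mor0 f x) (mor0 f y) - mor0 f (br V x y)"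
    "x \<in> deg0 V \<Longrightarrow> a \<in> deg1 V \<Longrightarrow>
      mor2 f x (bd V a) = mbr W (mor0 f x) (mor1 f a) - mor1 f (mbr V x a)"
    "x \<in> deg0 V \<Longrightarrow> y \<in> deg0 V \<Longrightarrow> z \<in> deg0 V \<Longrightarrow>
      jac W (mor0 f x) (mor0 f y) (mor0 f z) - mor1 f (jac V x y z) =
        (mbr W (mor0 f x) (mor2 f y z) + mor2 f x (br V y z)) +
        (mbr W (mor0 f y) (mor2 f z x) + mor2 f y (br V z x)) +
        (mbr W (mor0 f z) (mor2 f x y) + mor2 f z (br V x y))"
proof -
  have f: "bilin_on (deg0 V) (deg0 V) (deg1 W) (mor2 f)"
    using assms unfolding lie2_morphism_def by blast
  show "x \<in> deg0 V \<Longrightarrow> lin_on (deg0 V) (deg1 W) (mor2 f x)"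
    "x \<in> deg0 V \<Longrightarrow> lin_on (deg0 V) (deg1 W) (\<lambda>y. mor2 f y x)"
    by (rule bilin_onD[OF f], assumption)+
qed (use assms in \<open>unfold lie2_morphism_def, blast\<close>)+

text \<open>The Jacobiator axiom is the only one with content: it is the axiom for \<open>f\<close>
  pushed forward by \<open>mor1 g\<close>, plus the axiom for \<open>g\<close> at the images under
  \<open>mor0 f\<close>. The step \<open>inner\<close> shows that each cyclic summand splits
  accordingly.\<close>

lemma lie2_morphism_comp:
  assumes f: "lie2_morphism U V f" and g: "lie2_morphism V W g"
  shows "lie2_morphism U W (lie2_comp g f)"
proof -
  note f' = lie2_morphismD[OF f] and g' = lie2_morphismD[OF g]
  note U = lie2_algebraD[OF f'(1)] and V = lie2_algebraD[OF f'(2)] and W = lie2_algebraD[OF g'(2)]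
  have f0: "mor0 f x \<in> deg0 V" if "x \<in> deg0 U" for x
    using lin_onD(1)[OF f'(3) that] .
  have f1: "mor1 f a \<in> deg1 V" if "a \<in> deg1 U" for a
    using lin_onD(1)[OF f'(4) that] .
  have f2: "mor2 f x y \<in> deg1 V" if "x \<in> deg0 U" "y \<in> deg0 U" for x y
    using lin_onD(1)[OF f'(6)] that .
  have g2: "mor2 g x y \<in> deg1 W" if "x \<in> deg0 V" "y \<in> deg0 V" for x y
    using lin_onD(1)[OF g'(6)] that .
  have g1: "mor1 g a \<in> deg1 W" if "a \<in> deg1 V" for a
    using lin_onD(1)[OF g'(4) that] .
  have g0: "mor0 g a \<in> deg0 W" if "a \<in> deg0 V" for a
    using lin_onD(1)[OF g'(3) that] .
  have skew: "mor1 g (mor2 f x y) + mor2 g (mor0 f x) (mor0 f y)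
      = - (mor1 g (mor2 f y x) + mor2 g (mor0 f y) (mor0 f x))"
    if "x \<in> deg0 U" "y \<in> deg0 U" for x y
    using that f'(8)[of x y] g'(8)[of "mor0 f x" "mor0 f y"]
      lin_on_minus[OF g'(4) V(2), of "mor2 f y x"] f0 f2 by simp
  have bd: "bd W (mor1 g (mor2 f x y) + mor2 g (mor0 f x) (mor0 f y))
      = br W (mor0 g (mor0 f x)) (mor0 g (mor0 f y)) - mor0 g (mor0 f (br U x y))"
    if "x \<in> deg0 U" "y \<in> deg0 U" for x y
  proof -
    have "bd W (mor1 g (mor2 f x y) + mor2 g (mor0 f x) (mor0 f y))
        = bd W (mor1 g (mor2 f x y)) + bd W (mor2 g (mor0 f x) (mor0 f y))"
      using that by (intro lin_onD(2)[OF W(3)] f2 f0 g1 g2)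
    also have "bd W (mor1 g (mor2 f x y)) = mor0 g (bd V (mor2 f x y))"
      using that by (intro g'(5) f2)
    also have "\<dots> = mor0 g (br V (mor0 f x) (mor0 f y)) - mor0 g (mor0 f (br U x y))"
      using that by (simp add: f'(9) lin_on_diff[OF g'(3) V(1)] V(4) U(4) f0)
    also have "bd W (mor2 g (mor0 f x) (mor0 f y))
        = br W (mor0 g (mor0 f x)) (mor0 g (mor0 f y)) - mor0 g (br V (mor0 f x) (mor0 f y))"
      using that by (intro g'(9) f0)
    finally show ?thesis by simp
  qed
  have mixed: "mor1 g (mor2 f x (bd U a)) + mor2 g (mor0 f x) (mor0 f (bd U a))
      = mbr W (mor0 g (mor0 f x)) (mor1 g (mor1 f a)) - mor1 g (mor1 f (mbr U x a))"
    if "x \<in> deg0 U" "a \<in> deg1 U" for x a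
    using that g'(10)[of "mor0 f x" "mor1 f a"]
    by (simp add: f'(10) f'(5)[symmetric] lin_on_diff[OF g'(4) V(2)] V(6) U(6) f0 f1)
  \<comment> \<open>The axiom of \<open>g\<close> for \<open>mor2 g\<close> on a boundary, taken at
    the boundary of \<open>mor2 f y z\<close>, trades the bracket with
    \<open>mor1 g (mor2 f y z)\<close> for a term in the image of \<open>mor1 g\<close>. That
    boundary is \<open>br V (mor0 f y) (mor0 f z) - mor0 f (br U y z)\<close>, and its second part
    cancels the term \<open>mor2 g (mor0 f x) (mor0 f (br U y z))\<close>.\<close>
  have inner: "mbr W (mor0 g (mor0 f x)) (mor1 g (mor2 f y z) + mor2 g (mor0 f y) (mor0 f z))
      + (mor1 g (mor2 f x (br U y z)) + mor2 g (mor0 f x) (mor0 f (br U y z)))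
    = mor1 g (mbr V (mor0 f x) (mor2 f y z) + mor2 f x (br U y z))
      + (mbr W (mor0 g (mor0 f x)) (mor2 g (mor0 f y) (mor0 f z))
        + mor2 g (mor0 f x) (br V (mor0 f y) (mor0 f z)))"
    if x: "x \<in> deg0 U" and y: "y \<in> deg0 U" and z: "z \<in> deg0 U" for x y z
  proof -
    have "mbr W (mor0 g (mor0 f x)) (mor1 g (mor2 f y z))
        = mor1 g (mbr V (mor0 f x) (mor2 f y z)) + mor2 g (mor0 f x) (bd V (mor2 f y z))"
      using g'(10)[OF f0[OF x] f2[OF y z]] by simp
    also have "mor2 g (mor0 f x) (bd V (mor2 f y z))
        = mor2 g (mor0 f x) (br V (mor0 f y) (mor0 f z)) - mor2 g (mor0 f x) (mor0 f (br U y z))"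
      using x y z by (simp add: f'(9) lin_on_diff[OF g'(6) V(1)] V(4) U(4) f0)
    finally show ?thesis
      using x y z
      by (simp add: lin_onD(2)[OF W(5)] lin_onD(2)[OF g'(4)] f0 f2 g0 g1 g2 U(4) V(6))
  qed
  have jac: "jac W (mor0 g (mor0 f x)) (mor0 g (mor0 f y)) (mor0 g (mor0 f z))
      - mor1 g (mor1 f (jac U x y z)) =
    (mbr W (mor0 g (mor0 f x)) (mor1 g (mor2 f y z) + mor2 g (mor0 f y) (mor0 f z))
      + (mor1 g (mor2 f x (br U y z)) + mor2 g (mor0 f x) (mor0 f (br U y z)))) +
    (mbr W (mor0 g (mor0 f y)) (mor1 g (mor2 f z x) + mor2 g (mor0 f z) (mor0 f x))
      + (mor1 g (mor2 f y (br U z x)) + mor2 g (mor0 f y) (mor0 f (br U z x)))) +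
    (mbr W (mor0 g (mor0 f z)) (mor1 g (mor2 f x y) + mor2 g (mor0 f x) (mor0 f y))
      + (mor1 g (mor2 f z (br U x y)) + mor2 g (mor0 f z) (mor0 f (br U x y))))"
    if x: "x \<in> deg0 U" and y: "y \<in> deg0 U" and z: "z \<in> deg0 U" for x y z
  proof -
    have c: "mbr V (mor0 f x) (mor2 f y z) + mor2 f x (br U y z) \<in> deg1 V"
      if "x \<in> deg0 U" "y \<in> deg0 U" "z \<in> deg0 U" for x y z
      using that by (intro subspace_add[OF V(2)] V(6) f0 f2 U(4))
    have "jac V (mor0 f x) (mor0 f y) (mor0 f z) = mor1 f (jac U x y z)
        + ((mbr V (mor0 f x) (mor2 f y z) + mor2 f x (br U y z)) +
        (mbr V (mor0 f y) (mor2 f z x) + mor2 f y (br U z x)) +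
        (mbr V (mor0 f z) (mor2 f x y) + mor2 f z (br U x y)))"
      using f'(11)[OF x y z] by (simp add: algebra_simps)
    then have "mor1 g (jac V (mor0 f x) (mor0 f y) (mor0 f z)) = mor1 g (mor1 f (jac U x y z))
        + (mor1 g (mbr V (mor0 f x) (mor2 f y z) + mor2 f x (br U y z)) +
        mor1 g (mbr V (mor0 f y) (mor2 f z x) + mor2 f y (br U z x)) +
        mor1 g (mbr V (mor0 f z) (mor2 f x y) + mor2 f z (br U x y)))"
      using c[OF x y z] c[OF y z x] c[OF z x y] f1[OF U(7)[OF x y z]]
      by (simp only: lin_onD(2)[OF g'(4)] subspace_add[OF V(2)])
    then show ?thesis
      unfolding inner[OF x y z] inner[OF y z x] inner[OF z x y]
      using g'(11)[OF f0[OF x] f0[OF y] f0[OF z]] by (simp add: algebra_simps)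
  qed
  have bilin: "bilin_on (deg0 U) (deg0 U) (deg1 W)
      (\<lambda>x y. mor1 g (mor2 f x y) + mor2 g (mor0 f x) (mor0 f y))"
    unfolding bilin_on_def
    by (intro conjI ballI lin_on_add[OF W(2)] lin_on_comp[OF g'(4) f'(6)] lin_on_comp[OF g'(4) f'(7)]
        lin_on_comp[OF g'(6)[OF f0] f'(3)] lin_on_comp[OF g'(7)[OF f0] f'(3)])
  have bd1: "bd W (mor1 g (mor1 f a)) = mor0 g (mor0 f (bd U a))" if "a \<in> deg1 U" for a
    using that by (simp add: f'(5) g'(5) f1)
  show ?thesis
    unfolding lie2_morphism_def lie2_comp_def lie2_mor.simps comp_def
    by (intro conjI ballI f'(1) g'(2) lin_on_comp[OF g'(3) f'(3)] lin_on_comp[OF g'(4) f'(4)]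
        skew bilin bd bd1 mixed jac)
qed

lemma lie2_morphism_strictI:
  assumes V: "lie2_algebra V" and W: "lie2_algebra W"
    and f0: "lin_on (deg0 V) (deg0 W) f0" and f1: "lin_on (deg1 V) (deg1 W) f1"
    and bd: "\<And>a. a \<in> deg1 V \<Longrightarrow> bd W (f1 a) = f0 (bd V a)"
    and br: "\<And>x y. x \<in> deg0 V \<Longrightarrow> y \<in> deg0 V \<Longrightarrow> br W (f0 x) (f0 y) = f0 (br V x y)"
    and mbr: "\<And>x a. x \<in> deg0 V \<Longrightarrow> a \<in> deg1 V \<Longrightarrow> mbr W (f0 x) (f1 a) = f1 (mbr V x a)"
    and jac: "\<And>x y z. x \<in> deg0 V \<Longrightarrow> y \<in> deg0 V \<Longrightarrow> z \<in> deg0 V \<Longrightarrow>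
      jac W (f0 x) (f0 y) (f0 z) = f1 (jac V x y z)"
  shows "lie2_morphism V W \<lparr>mor0 = f0, mor1 = f1, mor2 = (\<lambda>_ _. 0)\<rparr>"
proof -
  note W' = lie2_algebraD[OF W]
  have "bilin_on (deg0 V) (deg0 V) (deg1 W) (\<lambda>_ _. 0)"
    unfolding bilin_on_def by (intro conjI ballI lin_on_zero[OF W'(2)])
  moreover have "bd W 0 = 0"
    by (rule lin_on_0[OF W'(3,2)])
  moreover have "mbr W (f0 x) 0 = 0" if "x \<in> deg0 V" for x
    by (rule lin_on_0[OF W'(5) W'(2)]) (rule lin_onD(1)[OF f0 that])
  ultimately show ?thesis
    using V W f0 f1 by (simp add: lie2_morphism_def bd br mbr jac)
qed

text \<open>Off the carriers the components of a morphism are junk, so equal morphisms need not be equal as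
  records.\<close>

lemma two_isomorphic_if_eq_on:
  assumes f: "lie2_morphism V W f"
    and 0: "\<And>x. x \<in> deg0 V \<Longrightarrow> mor0 g x = mor0 f x"
    and 1: "\<And>a. a \<in> deg1 V \<Longrightarrow> mor1 g a = mor1 f a"
    and 2: "\<And>x y. x \<in> deg0 V \<Longrightarrow> y \<in> deg0 V \<Longrightarrow> mor2 g x y = mor2 f x y"
  shows "two_isomorphic V W f g"
proof -
  note f' = lie2_morphismD[OF f]
  note V = lie2_algebraD[OF f'(1)]
  have bd: "bd V a \<in> deg0 V" if "a \<in> deg1 V" for a
    using lin_onD(1)[OF V(3) that] .
  \<comment> \<open>The subspace hypothesis keeps sums and multiples inside \<open>A\<close>, the
    only place where \<open>h'\<close> and \<open>h\<close> are known to agree.\<close>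
  have lin: "lin_on A B h' \<longleftrightarrow> lin_on A B h" if "\<And>x. x \<in> A \<Longrightarrow> h' x = h x" "subspace A"
    for A :: "'x::real_vector set" and B :: "'y::real_vector set" and h h'
    using that by (auto simp: lin_on_def subspace_add subspace_scale image_subset_iff)
  have lin01: "lin_on (deg0 V) (deg0 W) (mor0 g)" "lin_on (deg1 V) (deg1 W) (mor1 g)"
    using lin[OF 0 V(1)] lin[OF 1 V(2)] f'(3,4) by auto
  have bilin: "bilin_on (deg0 V) (deg0 V) (deg1 W) (mor2 g)"
    unfolding bilin_on_def using lin[OF 2 V(1)] lin[OF 2 V(1)] f'(6,7) by auto
  have "lie2_morphism V W g"
    unfolding lie2_morphism_def
    \<comment> \<open>The membership facts place every argument in a carrier, so all components of
      \<open>g\<close> turn into those of \<open>f\<close> and the axioms of \<open>f\<close> are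
      left.\<close>
    by (intro conjI ballI f'(1,2) lin01 bilin, simp_all only: 0 1 2 V(4,6,7) bd)
      (rule f'(5,8,9,10,11); assumption)+
  moreover have "butterfly_iso V W (butterfly_of V W f) (butterfly_of V W g) (\<lambda>e. e)"
    using bij_betw_id by (auto simp: butterfly_iso_def butterfly_of_def lin_on_def 0 1 2 bij_betw_def)
  ultimately show ?thesis
    using f unfolding two_isomorphic_def by blast
qed

section \<open>Smooth functions\<close>

text \<open>The bound \<open>i < n\<close> matters: moving a coordinate from index \<open>n\<close>
  on would leave \<open>Euclidean_space n\<close>, whose sequences vanish there.\<close>

lemma eventually_coordinate_line:
  assumes "openin (Euclidean_space n) U" "x \<in> U" "i < n"
  shows "\<forall>\<^sub>F t in nhds (x i). x(i := t) \<in> U"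
proof -
  have x: "x \<in> topspace (Euclidean_space n)"
    using assms openin_subset by blast
  have "continuous_map euclideanreal (Euclidean_space n) (\<lambda>t. x(i := t))"
    using x assms(3)
    by (auto simp: Euclidean_space_def continuous_map_in_subtopology
        continuous_map_componentwise_UNIV)
  then have "open {t. x(i := t) \<in> U}"
    using openin_continuous_map_preimage[OF _ assms(1)] by fastforce
  then show ?thesis
    using assms(2) by (auto simp: eventually_nhds intro!: exI[of _ "{t. x(i := t) \<in> U}"])
qed

text \<open>A partial derivative at a point of \<open>U\<close> depends only on nearby points of a
  coordinate line, and those still lie in \<open>U\<close>. The lemma is needed because the sum and
  product rules for \<open>partial_deriv\<close> are available only on \<open>U\<close>; elsewhere
  \<open>deriv\<close> may be applied to a function that is not differentiable.\<close>

lemma Ck_on_cong: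
  assumes U: "openin (Euclidean_space n) U" and "\<And>x. x \<in> U \<Longrightarrow> f x = g x" and "Ck_on k n U f"
  shows "Ck_on k n U g"
  using assms(2,3)
proof (induction k arbitrary: f g)
  case 0
  then show ?case
    by (auto elim!: continuous_map_eq)
next
  case (Suc k)
  have ev: "\<forall>\<^sub>F t in nhds (x i). f (x(i := t)) = g (x(i := t))" if "x \<in> U" "i < n" for x i
    using eventually_coordinate_line[OF U that] by eventually_elim (rule Suc.prems)
  have "(\<lambda>t. g (x(i := t))) differentiable (at (x i))" if "x \<in> U" "i < n" for x i
  proof -
    have "(\<lambda>t. f (x(i := t))) differentiable (at (x i))"
      using Suc.prems(2) that by simp
    then show ?thesis
      using ev[OF that] unfolding real_differentiable_def
      by (metis DERIV_cong_ev)
  qed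
  moreover have "Ck_on k n U (partial_deriv i g)" if "i < n" for i
  proof (rule Suc.IH)
    show "Ck_on k n U (partial_deriv i f)"
      using Suc.prems(2) that by simp
    show "partial_deriv i f x = partial_deriv i g x" if "x \<in> U" for x
      unfolding partial_deriv_def using ev[OF that \<open>i < n\<close>] by (intro deriv_cong_ev) auto
  qed
  moreover have "continuous_map (subtopology (Euclidean_space n) U) euclideanreal g"
    using Suc.prems by (auto elim!: continuous_map_eq)
  ultimately show ?case
    by simp
qed

lemma Ck_on_SucD: "Ck_on (Suc k) n U f \<Longrightarrow> Ck_on k n U f"
  by (induction k arbitrary: f) auto

lemma Ck_on_const: "Ck_on k n U (\<lambda>_. c)"
proof (induction k arbitrary: c)
  case (Suc k)
  have "partial_deriv i (\<lambda>_. c) = (\<lambda>_. 0)" for i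
    by (simp add: partial_deriv_def fun_eq_iff)
  then show ?case
    using Suc by simp
qed simp

lemma Ck_on_add:
  assumes U: "openin (Euclidean_space n) U" and "Ck_on k n U f" "Ck_on k n U g"
  shows "Ck_on k n U (\<lambda>x. f x + g x)"
  using assms(2,3)
proof (induction k arbitrary: f g)
  case (Suc k)
  have "Ck_on k n U (partial_deriv i (\<lambda>x. f x + g x))" if "i < n" for i
  proof (rule Ck_on_cong[OF U])
    show "Ck_on k n U (\<lambda>x. partial_deriv i f x + partial_deriv i g x)"
      using Suc that by simp
    show "partial_deriv i f x + partial_deriv i g x = partial_deriv i (\<lambda>x. f x + g x) x"
      if "x \<in> U" for x
      using Suc.prems \<open>i < n\<close> that unfolding partial_deriv_def
      by (subst deriv_add) (auto simp: field_differentiable_def real_differentiable_def)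
  qed
  then show ?case
    using Suc.prems by (auto intro: continuous_map_add)
qed (auto intro: continuous_map_add)

text \<open>The product rule pairs each function with a derivative of the other, which has one order
  less. \<open>Ck_on_SucD\<close> lowers the order of the undifferentiated factor so that the
  induction hypothesis covers both products.\<close>

lemma Ck_on_mult:
  assumes U: "openin (Euclidean_space n) U" and "Ck_on k n U f" "Ck_on k n U g"
  shows "Ck_on k n U (\<lambda>x. f x * g x)"
  using assms(2,3)
proof (induction k arbitrary: f g)
  case (Suc k)
  note k = Suc.prems[THEN Ck_on_SucD]
  have "Ck_on k n U (partial_deriv i (\<lambda>x. f x * g x))" if "i < n" for i
  proof (rule Ck_on_cong[OF U])
    show "Ck_on k n U (\<lambda>x. f x * partial_deriv i g x + partial_deriv i f x * g x)"
      using Suc that k by (intro Ck_on_add[OF U] Suc.IH) simp_all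
    show "f x * partial_deriv i g x + partial_deriv i f x * g x = partial_deriv i (\<lambda>x. f x * g x) x"
      if "x \<in> U" for x
      using Suc.prems \<open>i < n\<close> that unfolding partial_deriv_def
      by (subst deriv_mult) (auto simp: field_differentiable_def real_differentiable_def)
  qed
  then show ?case
    using Suc.prems by (auto intro: continuous_map_real_mult)
qed (auto intro: continuous_map_real_mult)

locale smooth_manifold =
  fixes M :: "'a manifold"
  assumes manifold: "is_manifold M"
begin

lemma open_chart_image: "(U, \<phi>) \<in> atlas M \<Longrightarrow> openin (Euclidean_space (mdim M)) (\<phi> ` U)"
  using manifold by (auto simp: is_manifold_def)

lemma Cinf_add [simp]: "f \<in> Cinf M \<Longrightarrow> g \<in> Cinf M \<Longrightarrow> f + g \<in> Cinf M"
  unfolding Cinf_def smooth_on_def by (auto intro!: Ck_on_add open_chart_image)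

lemma Cinf_mult [simp]: "f \<in> Cinf M \<Longrightarrow> g \<in> Cinf M \<Longrightarrow> f * g \<in> Cinf M"
  unfolding Cinf_def smooth_on_def by (auto intro!: Ck_on_mult open_chart_image)

text \<open>Constants are set to zero outside \<open>pts M\<close>, as membership in
  \<open>Cinf M\<close> demands.\<close>

definition const_fn :: "real \<Rightarrow> 'a fn" where
  "const_fn c = (\<lambda>p. if p \<in> pts M then c else 0)"

lemma Cinf_const [simp]: "const_fn c \<in> Cinf M"
proof -
  have "Ck_on k (mdim M) (\<phi> ` U) (\<lambda>x. const_fn c (inv_into U \<phi> x))" if "(U, \<phi>) \<in> atlas M" for k U \<phi>
  proof (rule Ck_on_cong[OF open_chart_image[OF that] _ Ck_on_const])
    have "U \<subseteq> pts M"
      using manifold that by (auto simp: is_manifold_def)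
    then show "c = const_fn c (inv_into U \<phi> x)" if "x \<in> \<phi> ` U" for x
      using inv_into_into[OF that] by (auto simp: const_fn_def)
  qed
  then show ?thesis
    by (auto simp: Cinf_def smooth_on_def const_fn_def)
qed

lemma const_fn_mult: "f \<in> Cinf M \<Longrightarrow> const_fn c * f = c *\<^sub>R f"
  by (auto simp: Cinf_def const_fn_def scaleR_fun_def fun_eq_iff)

lemma Cinf_scaleR [simp]: "f \<in> Cinf M \<Longrightarrow> c *\<^sub>R f \<in> Cinf M"
  using Cinf_mult[OF Cinf_const] const_fn_mult by metis

lemma subspace_Cinf: "subspace (Cinf M)"
proof -
  have "const_fn 0 = 0"
    by (auto simp: const_fn_def)
  then show ?thesis
    using Cinf_const[of 0] by (auto simp: subspace_def)
qed

end

section \<open>Vector fields and differential forms\<close>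

lemma scaleR_fun_apply [simp]: "(c *\<^sub>R f) x = c *\<^sub>R f x"
  by (simp add: scaleR_fun_def)

lemma vmul_apply [simp]: "vmul f X g = f * X g"
  by (simp add: vmul_def)

lemma vbr_apply [simp]: "vbr X Y f = X (Y f) - Y (X f)"
  by (simp add: vbr_def)

lemma vbr_skew: "vbr Y X = - vbr X Y"
  by (simp add: fun_eq_iff)

context smooth_manifold
begin

lemma Cinf_simps [simp]:
  "0 \<in> Cinf M"
  "f \<in> Cinf M \<Longrightarrow> - f \<in> Cinf M"
  "f \<in> Cinf M \<Longrightarrow> g \<in> Cinf M \<Longrightarrow> f - g \<in> Cinf M"
  using subspace_Cinf by (auto intro: subspace_0 subspace_neg subspace_diff)

lemma lin_on_vfield: "X \<in> vfields M \<Longrightarrow> lin_on (Cinf M) (Cinf M) X"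
  by (rule lin_onI) (simp_all add: vfields_def)

lemma vfield_Cinf [simp]: "X \<in> vfields M \<Longrightarrow> f \<in> Cinf M \<Longrightarrow> X f \<in> Cinf M"
  by (rule lin_onD[OF lin_on_vfield])

lemma vfield_mult:
  "X \<in> vfields M \<Longrightarrow> f \<in> Cinf M \<Longrightarrow> g \<in> Cinf M \<Longrightarrow> X (f * g) = X f * g + f * X g"
  unfolding vfields_def by blast

text \<open>These rules, like \<open>form1_linear\<close>, \<open>form2_linear\<close> and \<open>form3_linear\<close> below, have a variable as head
  symbol; the simplifier needs them instantiated to the vector field or form at hand.\<close>

lemmas vfield_linear =
  lin_onD(2,3)[OF lin_on_vfield] lin_on_0[OF lin_on_vfield subspace_Cinf]
  lin_on_minus[OF lin_on_vfield subspace_Cinf] lin_on_diff[OF lin_on_vfield subspace_Cinf]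
  vfield_mult

lemma vfield_outside: "X \<in> vfields M \<Longrightarrow> f \<notin> Cinf M \<Longrightarrow> X f = 0"
  unfolding vfields_def by blast

text \<open>Vector fields vanish on non-smooth arguments, so testing on smooth functions suffices.
  Evaluating at a point as well leaves goals about real numbers.\<close>

lemma vfield_eqI:
  assumes "X \<in> vfields M" "Y \<in> vfields M" "\<And>f p. f \<in> Cinf M \<Longrightarrow> X f p = Y f p"
  shows "X = Y"
proof
  show "X f = Y f" for f
    using assms by (cases "f \<in> Cinf M") (simp_all add: vfield_outside[of X] vfield_outside[of Y] fun_eq_iff)
qed

lemma vfieldsI:
  assumes "\<And>f. f \<notin> Cinf M \<Longrightarrow> X f = 0" "\<And>f. f \<in> Cinf M \<Longrightarrow> X f \<in> Cinf M"
    and "\<And>f g. f \<in> Cinf M \<Longrightarrow> g \<in> Cinf M \<Longrightarrow> X (f + g) = X f + X g"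
    and "\<And>c f. f \<in> Cinf M \<Longrightarrow> X (c *\<^sub>R f) = c *\<^sub>R X f"
    and "\<And>f g. f \<in> Cinf M \<Longrightarrow> g \<in> Cinf M \<Longrightarrow> X (f * g) = X f * g + f * X g"
  shows "X \<in> vfields M"
  using assms unfolding vfields_def by blast

lemma vfields_add [simp]:
  assumes X: "X \<in> vfields M" and Y: "Y \<in> vfields M"
  shows "X + Y \<in> vfields M"
  using assms
  by (intro vfieldsI)
    (simp_all add: vfield_outside[OF X] vfield_outside[OF Y] vfield_linear[OF X] vfield_linear[OF Y]
      algebra_simps)

lemma vfields_vmul [simp]:
  assumes f: "f \<in> Cinf M" and X: "X \<in> vfields M"
  shows "vmul f X \<in> vfields M"
  using assms
  by (intro vfieldsI) (simp_all add: vfield_outside[OF X] vfield_linear[OF X] fun_eq_iff algebra_simps)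

text \<open>Forms are defined by additivity and homogeneity over smooth functions only. Writing a
  real multiple as multiplication by a constant function gives them real homogeneity.\<close>

lemma scaleR_eq_vmul:
  assumes "X \<in> vfields M"
  shows "c *\<^sub>R X = vmul (const_fn c) X"
proof
  show "(c *\<^sub>R X) f = vmul (const_fn c) X f" for f
    using assms by (cases "f \<in> Cinf M") (simp_all add: const_fn_mult vfield_outside[of X])
qed

lemma vfields_scaleR [simp]: "X \<in> vfields M \<Longrightarrow> c *\<^sub>R X \<in> vfields M"
  by (simp add: scaleR_eq_vmul)

lemma subspace_vfields: "subspace (vfields M)"
proof -
  have "0 \<in> vfields M"
    by (rule vfieldsI) simp_all
  then show ?thesis
    by (simp add: subspace_def)
qed

lemma vfields_simps [simp]:
  "0 \<in> vfields M"
  "X \<in> vfields M \<Longrightarrow> - X \<in> vfields M"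
  "X \<in> vfields M \<Longrightarrow> Y \<in> vfields M \<Longrightarrow> X - Y \<in> vfields M"
  using subspace_vfields by (auto intro: subspace_0 subspace_neg subspace_diff)

text \<open>The mixed products \<open>X f * Y g\<close> and \<open>Y f * X g\<close> are symmetric
  in \<open>X\<close> and \<open>Y\<close>, so they cancel in the commutator and the Leibniz rule
  survives.\<close>

lemma vfields_vbr [simp]:
  assumes X: "X \<in> vfields M" and Y: "Y \<in> vfields M"
  shows "vbr X Y \<in> vfields M"
  using assms
  by (intro vfieldsI)
    (simp_all add: vfield_outside[OF X] vfield_outside[OF Y] vfield_linear[OF X] vfield_linear[OF Y]
      fun_eq_iff algebra_simps)

lemma lin_on_vbr:
  assumes X: "X \<in> vfields M"
  shows "lin_on (vfields M) (vfields M) (vbr X)"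
proof (rule lin_onI)
  show "vbr X (Y + Z) = vbr X Y + vbr X Z" if "Y \<in> vfields M" "Z \<in> vfields M" for Y Z
    using X that by (intro vfield_eqI) (simp_all add: vfield_linear[OF X])
  show "vbr X (c *\<^sub>R Y) = c *\<^sub>R vbr X Y" if "Y \<in> vfields M" for c Y
    using X that by (intro vfield_eqI) (simp_all add: vfield_linear[OF X] vfield_linear[OF that] algebra_simps)
qed (simp add: X)

lemmas vbr_right_simps [simp] =
  lin_onD(2,3)[OF lin_on_vbr] lin_on_0[OF lin_on_vbr subspace_vfields]
  lin_on_minus[OF lin_on_vbr subspace_vfields] lin_on_diff[OF lin_on_vbr subspace_vfields]

lemma lin_on_vbr_left: "X \<in> vfields M \<Longrightarrow> lin_on (vfields M) (vfields M) (\<lambda>Y. vbr Y X)"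
  by (rule lin_onI) (simp_all add: vbr_skew[of _ X])

lemmas vbr_left_simps [simp] =
  lin_onD(2,3)[OF lin_on_vbr_left] lin_on_0[OF lin_on_vbr_left subspace_vfields]
  lin_on_minus[OF lin_on_vbr_left subspace_vfields] lin_on_diff[OF lin_on_vbr_left subspace_vfields]

lemma vbr_vmul_right:
  assumes f: "f \<in> Cinf M" and X: "X \<in> vfields M" and Y: "Y \<in> vfields M"
  shows "vbr X (vmul f Y) = vmul (X f) Y + vmul f (vbr X Y)"
  using assms by (intro vfield_eqI) (simp_all add: vfield_linear[OF X] algebra_simps)

lemma vbr_vmul_left:
  assumes f: "f \<in> Cinf M" and X: "X \<in> vfields M" and Y: "Y \<in> vfields M"
  shows "vbr (vmul f X) Y = vmul f (vbr X Y) - vmul (Y f) X"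
  using assms by (intro vfield_eqI) (simp_all add: vfield_linear[OF Y] algebra_simps)

text \<open>The Jacobi identity, oriented: at three fixed fields it eliminates one of the three
  nested brackets, leaving no hidden relation among the remaining terms.\<close>

lemma vbr_jacobi:
  assumes X: "X \<in> vfields M" and Y: "Y \<in> vfields M" and Z: "Z \<in> vfields M"
  shows "vbr (vbr Y Z) X = vbr (vbr X Z) Y - vbr (vbr X Y) Z"
  using assms
  by (intro vfield_eqI)
    (simp_all add: vfield_linear[OF X] vfield_linear[OF Y] vfield_linear[OF Z])

section \<open>Differential forms as alternating maps linear over smooth functions\<close>

lemma forms1I:
  assumes "\<And>X. X \<notin> vfields M \<Longrightarrow> \<alpha> X = 0" "\<And>X. X \<in> vfields M \<Longrightarrow> \<alpha> X \<in> Cinf M"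
    and "\<And>X Y. X \<in> vfields M \<Longrightarrow> Y \<in> vfields M \<Longrightarrow> \<alpha> (X + Y) = \<alpha> X + \<alpha> Y"
    and "\<And>f X. f \<in> Cinf M \<Longrightarrow> X \<in> vfields M \<Longrightarrow> \<alpha> (vmul f X) = f * \<alpha> X"
  shows "\<alpha> \<in> forms1 M"
  using assms unfolding forms1_def by blast

lemma form1_outside: "\<alpha> \<in> forms1 M \<Longrightarrow> X \<notin> vfields M \<Longrightarrow> \<alpha> X = 0"
  unfolding forms1_def by blast

lemma form1_Cinf [simp]: "\<alpha> \<in> forms1 M \<Longrightarrow> X \<in> vfields M \<Longrightarrow> \<alpha> X \<in> Cinf M"
  unfolding forms1_def by blast

lemma form1_vmul:
  "\<alpha> \<in> forms1 M \<Longrightarrow> f \<in> Cinf M \<Longrightarrow> X \<in> vfields M \<Longrightarrow> \<alpha> (vmul f X) = f * \<alpha> X"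
  unfolding forms1_def by blast

lemma lin_on_form1:
  assumes "\<alpha> \<in> forms1 M"
  shows "lin_on (vfields M) (Cinf M) \<alpha>"
proof (rule lin_onI)
  show "\<alpha> (X + Y) = \<alpha> X + \<alpha> Y" if "X \<in> vfields M" "Y \<in> vfields M" for X Y
    using assms that unfolding forms1_def by blast
  show "\<alpha> (c *\<^sub>R X) = c *\<^sub>R \<alpha> X" if "X \<in> vfields M" for c X
    using assms that by (simp add: scaleR_eq_vmul form1_vmul[OF assms] const_fn_mult)
qed (simp add: assms)

lemmas form1_linear =
  lin_onD(2,3)[OF lin_on_form1] lin_on_0[OF lin_on_form1 subspace_vfields]
  lin_on_minus[OF lin_on_form1 subspace_vfields] lin_on_diff[OF lin_on_form1 subspace_vfields]
  form1_vmul

lemma form1_eqI: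
  assumes "\<alpha> \<in> forms1 M" "\<beta> \<in> forms1 M" "\<And>X p. X \<in> vfields M \<Longrightarrow> \<alpha> X p = \<beta> X p"
  shows "\<alpha> = \<beta>"
proof
  show "\<alpha> X = \<beta> X" for X
    using assms
    by (cases "X \<in> vfields M") (simp_all add: form1_outside[of \<alpha>] form1_outside[of \<beta>] fun_eq_iff)
qed

lemma subspace_forms1: "subspace (forms1 M)"
  unfolding subspace_def
proof (intro conjI ballI allI)
  show "0 \<in> forms1 M"
    by (rule forms1I) simp_all
  show "\<alpha> + \<beta> \<in> forms1 M" if \<alpha>: "\<alpha> \<in> forms1 M" and \<beta>: "\<beta> \<in> forms1 M" for \<alpha> \<beta>
    using that
    by (intro forms1I)
      (simp_all add: form1_outside[OF \<alpha>] form1_outside[OF \<beta>] form1_linear[OF \<alpha>] form1_linear[OF \<beta>]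
        algebra_simps)
  show "c *\<^sub>R \<alpha> \<in> forms1 M" if \<alpha>: "\<alpha> \<in> forms1 M" for c \<alpha>
    using that
    by (intro forms1I)
      (simp_all add: form1_outside[OF \<alpha>] form1_linear[OF \<alpha>] fun_eq_iff algebra_simps)
qed

lemma forms1_simps [simp]:
  "0 \<in> forms1 M"
  "\<alpha> \<in> forms1 M \<Longrightarrow> - \<alpha> \<in> forms1 M"
  "\<alpha> \<in> forms1 M \<Longrightarrow> c *\<^sub>R \<alpha> \<in> forms1 M"
  "\<alpha> \<in> forms1 M \<Longrightarrow> \<beta> \<in> forms1 M \<Longrightarrow> \<alpha> + \<beta> \<in> forms1 M"
  "\<alpha> \<in> forms1 M \<Longrightarrow> \<beta> \<in> forms1 M \<Longrightarrow> \<alpha> - \<beta> \<in> forms1 M"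
  using subspace_forms1
  by (auto intro: subspace_0 subspace_neg subspace_diff subspace_add subspace_scale)

lemma ext_d0_apply [simp]: "X \<in> vfields M \<Longrightarrow> ext_d0 M f X = X f"
  by (simp add: ext_d0_def)

lemma forms1_ext_d0 [simp]: "f \<in> Cinf M \<Longrightarrow> ext_d0 M f \<in> forms1 M"
  by (rule forms1I) (simp_all add: ext_d0_def)

lemma lie_deriv1_apply [simp]:
  "Y \<in> vfields M \<Longrightarrow> lie_deriv1 M X \<alpha> Y = X (\<alpha> Y) - \<alpha> (vbr X Y)"
  by (simp add: lie_deriv1_def)

text \<open>In homogeneity over smooth functions, the term with \<open>X f\<close> from the Leibniz
  rule cancels the one from \<open>vbr_vmul_right\<close>.\<close>

lemma forms1_lie_deriv1 [simp]:
  assumes X: "X \<in> vfields M" and \<alpha>: "\<alpha> \<in> forms1 M"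
  shows "lie_deriv1 M X \<alpha> \<in> forms1 M"
proof (rule forms1I)
  show "lie_deriv1 M X \<alpha> Y = 0" if "Y \<notin> vfields M" for Y
    using that by (simp add: lie_deriv1_def)
qed (use assms in \<open>simp_all add: vfield_linear[OF X] form1_linear[OF \<alpha>] vbr_vmul_right algebra_simps\<close>)

lemma form2_forms1 [simp]: "\<tau> \<in> forms2 M \<Longrightarrow> \<tau> X \<in> forms1 M"
  unfolding forms2_def by (cases "X \<in> vfields M") simp_all

lemma form2_vmul:
  assumes "\<tau> \<in> forms2 M" "f \<in> Cinf M" "X \<in> vfields M"
  shows "\<tau> (vmul f X) Y = f * \<tau> X Y"
proof -
  have "\<tau> (vmul f X) = (\<lambda>Y. f * \<tau> X Y)"
    using assms unfolding forms2_def by blast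
  then show ?thesis
    by simp
qed

lemma lin_on_form2:
  assumes "\<tau> \<in> forms2 M"
  shows "lin_on (vfields M) (forms1 M) \<tau>"
proof (rule lin_onI)
  show "\<tau> (X + Y) = \<tau> X + \<tau> Y" if "X \<in> vfields M" "Y \<in> vfields M" for X Y
    using assms that unfolding forms2_def by blast
  show "\<tau> (c *\<^sub>R X) = c *\<^sub>R \<tau> X" if "X \<in> vfields M" for c X
    using assms that
    by (intro form1_eqI) (simp_all add: scaleR_eq_vmul form2_vmul[OF assms] const_fn_mult)
qed (use assms in simp)

lemmas form2_linear =
  lin_onD(2,3)[OF lin_on_form2] lin_on_0[OF lin_on_form2 subspace_vfields]
  lin_on_minus[OF lin_on_form2 subspace_vfields] lin_on_diff[OF lin_on_form2 subspace_vfields]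
  form2_vmul form1_linear[OF form2_forms1]

lemma form2_self: "\<tau> \<in> forms2 M \<Longrightarrow> \<tau> X X = 0"
  unfolding forms2_def by (cases "X \<in> vfields M") auto

lemma form2_skew:
  assumes \<tau>: "\<tau> \<in> forms2 M" and "X \<in> vfields M" "Y \<in> vfields M"
  shows "\<tau> Y X = - \<tau> X Y"
proof -
  have "\<tau> (X + Y) (X + Y) = \<tau> X Y + \<tau> Y X"
    using assms by (simp add: form2_linear[OF \<tau>] form2_self[OF \<tau>, of X] form2_self[OF \<tau>, of Y] fun_eq_iff)
  then show ?thesis
    by (simp add: form2_self[OF \<tau>] eq_neg_iff_add_eq_0 add.commute)
qed

lemma form3_forms2 [simp]: "\<omega> \<in> forms3 M \<Longrightarrow> \<omega> X \<in> forms2 M"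
proof (cases "X \<in> vfields M")
  case True
  then show "\<omega> \<in> forms3 M \<Longrightarrow> \<omega> X \<in> forms2 M"
    unfolding forms3_def by blast
next
  case False
  have "0 \<in> forms2 M"
    unfolding forms2_def mem_Collect_eq by (intro conjI ballI allI impI ext) simp_all
  with False show "\<omega> \<in> forms3 M \<Longrightarrow> \<omega> X \<in> forms2 M"
    by (simp add: forms3_def)
qed

lemma form3_vmul:
  assumes "\<omega> \<in> forms3 M" "f \<in> Cinf M" "X \<in> vfields M"
  shows "\<omega> (vmul f X) Y Z = f * \<omega> X Y Z"
proof -
  have "\<omega> (vmul f X) = (\<lambda>Y Z. f * \<omega> X Y Z)"
    using assms unfolding forms3_def by blast
  then show ?thesis
    by simp
qed

lemma form3_outside:
  assumes "\<omega> \<in> forms3 M" "X \<notin> vfields M \<or> Y \<notin> vfields M \<or> Z \<notin> vfields M"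
  shows "\<omega> X Y Z = 0"
proof -
  have "\<omega> X Y = 0" if "Y \<notin> vfields M"
    using form3_forms2[OF assms(1), of X] that unfolding forms2_def by blast
  moreover have "\<omega> X = 0" if "X \<notin> vfields M"
    using assms(1) that unfolding forms3_def by blast
  ultimately show ?thesis
    using assms form1_outside[OF form2_forms1[OF form3_forms2[OF assms(1)]], of Z X Y] by auto
qed

text \<open>The codomain is the whole type: \<open>form3_forms2\<close> already provides membership
  of the values, and only the linear rules are extracted from here.\<close>

lemma lin_on_form3:
  assumes \<omega>: "\<omega> \<in> forms3 M"
  shows "lin_on (vfields M) {\<tau>. True} \<omega>"
proof (rule lin_onI)
  show "\<omega> (X + Y) = \<omega> X + \<omega> Y" if "X \<in> vfields M" "Y \<in> vfields M" for X Y
    using assms that unfolding forms3_def by blast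
  show "\<omega> (c *\<^sub>R X) = c *\<^sub>R \<omega> X" if X: "X \<in> vfields M" for c X
  proof (rule ext, rule form1_eqI)
    show "\<omega> (c *\<^sub>R X) Y Z p = (c *\<^sub>R \<omega> X) Y Z p" if Z: "Z \<in> vfields M" for Y Z p
      using X Z \<omega> by (simp add: scaleR_eq_vmul form3_vmul[OF \<omega>] const_fn_mult)
  qed (use \<omega> in simp_all)
qed simp

lemmas form3_linear =
  lin_onD(2,3)[OF lin_on_form3] lin_on_0[OF lin_on_form3 subspace_vfields]
  lin_on_minus[OF lin_on_form3 subspace_vfields] lin_on_diff[OF lin_on_form3 subspace_vfields]
  form3_vmul form2_linear[OF form3_forms2]

lemma form3_self: "\<omega> \<in> forms3 M \<Longrightarrow> \<omega> X X = 0"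
  unfolding forms3_def by (cases "X \<in> vfields M") auto

lemma form3_skew:
  assumes \<omega>: "\<omega> \<in> forms3 M" and "X \<in> vfields M" "Y \<in> vfields M"
  shows "\<omega> Y X = - \<omega> X Y"
proof -
  have "\<omega> (X + Y) (X + Y) = \<omega> X Y + \<omega> Y X"
    using assms by (simp add: form3_linear[OF \<omega>] form3_self[OF \<omega>, of X] form3_self[OF \<omega>, of Y] fun_eq_iff)
  then show ?thesis
    by (simp add: form3_self[OF \<omega>] eq_neg_iff_add_eq_0 add.commute)
qed

text \<open>The two adjacent transpositions generate all permutations, so skew-symmetry in them
  carries linearity from the first argument to the others. It also makes the map alternating, since
  a real function equal to its negative is zero. This spares unfolding the nested definitions of the
  form spaces.\<close>

lemma forms3I:
  assumes out: "\<And>X Y Z. X \<notin> vfields M \<or> Y \<notin> vfields M \<or> Z \<notin> vfields M \<Longrightarrow> \<omega> X Y Z = 0"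
    and Cinf: "\<And>X Y Z. X \<in> vfields M \<Longrightarrow> Y \<in> vfields M \<Longrightarrow> Z \<in> vfields M \<Longrightarrow> \<omega> X Y Z \<in> Cinf M"
    and add: "\<And>X X' Y Z. X \<in> vfields M \<Longrightarrow> X' \<in> vfields M \<Longrightarrow> Y \<in> vfields M \<Longrightarrow> Z \<in> vfields M \<Longrightarrow>
      \<omega> (X + X') Y Z = \<omega> X Y Z + \<omega> X' Y Z"
    and vmul: "\<And>f X Y Z. f \<in> Cinf M \<Longrightarrow> X \<in> vfields M \<Longrightarrow> Y \<in> vfields M \<Longrightarrow> Z \<in> vfields M \<Longrightarrow>
      \<omega> (vmul f X) Y Z = f * \<omega> X Y Z"
    and skew12: "\<And>X Y Z. X \<in> vfields M \<Longrightarrow> Y \<in> vfields M \<Longrightarrow> Z \<in> vfields M \<Longrightarrow>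
      \<omega> Y X Z = - \<omega> X Y Z"
    and skew23: "\<And>X Y Z. X \<in> vfields M \<Longrightarrow> Y \<in> vfields M \<Longrightarrow> Z \<in> vfields M \<Longrightarrow>
      \<omega> X Z Y = - \<omega> X Y Z"
  shows "\<omega> \<in> forms3 M"
proof -
  have skew13: "\<omega> Z Y X = - \<omega> X Y Z" if "X \<in> vfields M" "Y \<in> vfields M" "Z \<in> vfields M" for X Y Z
    using that skew12[of Y Z X] skew23[of Y X Z] skew12[of X Y Z] by simp
  have zero: "f = 0" if "f = - f" for f :: "'a fn"
    using that by (auto simp: fun_eq_iff)
  have alt: "\<omega> X X Y = 0" "\<omega> X Y Y = 0" for X Y
    using out[of X X Y] out[of X Y Y] zero[OF skew12[of X X Y]] zero[OF skew23[of X Y Y]]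
    by blast+
  have f1: "\<omega> X Y \<in> forms1 M" if "X \<in> vfields M" "Y \<in> vfields M" for X Y
  proof (rule forms1I)
    show "\<omega> X Y (Z + Z') = \<omega> X Y Z + \<omega> X Y Z'" if "Z \<in> vfields M" "Z' \<in> vfields M" for Z Z'
      using that \<open>X \<in> vfields M\<close> \<open>Y \<in> vfields M\<close> skew13[of "Z + Z'" Y X] skew13[of Z Y X] skew13[of Z' Y X]
      by (simp add: add)
    show "\<omega> X Y (vmul f Z) = f * \<omega> X Y Z" if "f \<in> Cinf M" "Z \<in> vfields M" for f Z
      using that \<open>X \<in> vfields M\<close> \<open>Y \<in> vfields M\<close> skew13[of "vmul f Z" Y X] skew13[of Z Y X]
      by (simp add: vmul)
  qed (use that out Cinf in auto)
  have f2: "\<omega> X \<in> forms2 M" if X: "X \<in> vfields M" for X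
  proof -
    have "\<omega> X Y = 0" if "Y \<notin> vfields M" for Y
      using that by (auto simp: out fun_eq_iff)
    moreover have "\<omega> X (Y + Y') = \<omega> X Y + \<omega> X Y'" if "Y \<in> vfields M" "Y' \<in> vfields M" for Y Y'
    proof
      show "\<omega> X (Y + Y') Z = (\<omega> X Y + \<omega> X Y') Z" for Z
        using that X skew12[of "Y + Y'" X Z] skew12[of Y X Z] skew12[of Y' X Z]
        by (cases "Z \<in> vfields M") (simp_all add: add out)
    qed
    moreover have "\<omega> X (vmul f Y) = (\<lambda>Z. f * \<omega> X Y Z)" if "Y \<in> vfields M" "f \<in> Cinf M" for f Y
    proof
      show "\<omega> X (vmul f Y) Z = f * \<omega> X Y Z" for Z
        using that X skew12[of "vmul f Y" X Z] skew12[of Y X Z]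
        by (cases "Z \<in> vfields M") (simp_all add: vmul out)
    qed
    ultimately show ?thesis
      using X f1 alt unfolding forms2_def by blast
  qed
  have "\<omega> X = 0" if "X \<notin> vfields M" for X
    using that by (auto simp: out fun_eq_iff)
  moreover have "\<omega> (X + X') = \<omega> X + \<omega> X'" if "X \<in> vfields M" "X' \<in> vfields M" for X X'
  proof (intro ext)
    show "\<omega> (X + X') Y Z p = (\<omega> X + \<omega> X') Y Z p" for Y Z p
      using that by (cases "Y \<in> vfields M \<and> Z \<in> vfields M") (auto simp: add out)
  qed
  moreover have "\<omega> (vmul f X) = (\<lambda>Y Z. f * \<omega> X Y Z)" if "X \<in> vfields M" "f \<in> Cinf M" for f X
  proof (intro ext)
    show "\<omega> (vmul f X) Y Z p = (f * \<omega> X Y Z) p" for Y Z p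
      using that by (cases "Y \<in> vfields M \<and> Z \<in> vfields M") (auto simp: vmul out)
  qed
  moreover have "\<omega> X X = 0" for X
    by (rule ext) (simp add: alt)
  ultimately show ?thesis
    using f2 unfolding forms3_def by blast
qed

subsection \<open>The exterior derivative of a 2-form\<close>

lemma forms3_add:
  assumes "\<omega> \<in> forms3 M" "\<eta> \<in> forms3 M"
  shows "\<omega> + \<eta> \<in> forms3 M"
proof (rule forms3I)
  show "(\<omega> + \<eta>) X Y Z = 0" if "X \<notin> vfields M \<or> Y \<notin> vfields M \<or> Z \<notin> vfields M" for X Y Z
    using form3_outside[OF assms(1) that] form3_outside[OF assms(2) that] by simp
  show "(\<omega> + \<eta>) Y X Z = - (\<omega> + \<eta>) X Y Z" if "X \<in> vfields M" "Y \<in> vfields M" for X Y Z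
    using form3_skew[OF assms(1) that] form3_skew[OF assms(2) that] by simp
  show "(\<omega> + \<eta>) X Z Y = - (\<omega> + \<eta>) X Y Z" if "Y \<in> vfields M" "Z \<in> vfields M" for X Y Z
    using form2_skew[OF form3_forms2[OF assms(1)] that] form2_skew[OF form3_forms2[OF assms(2)] that]
    by simp
qed (use assms in \<open>simp_all add: form3_linear[OF assms(1)] form3_linear[OF assms(2)] algebra_simps\<close>)

lemma ext_d2_apply:
  "X \<in> vfields M \<Longrightarrow> Y \<in> vfields M \<Longrightarrow> Z \<in> vfields M \<Longrightarrow>
    ext_d2 M \<tau> X Y Z = X (\<tau> Y Z) - Y (\<tau> X Z) + Z (\<tau> X Y)
      - \<tau> (vbr X Y) Z + \<tau> (vbr X Z) Y - \<tau> (vbr Y Z) X"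
  by (simp add: ext_d2_def)

text \<open>Homogeneity is the delicate point: the derivatives of \<open>f\<close> along
  \<open>Y\<close> and \<open>Z\<close> produced by the Leibniz rule cancel those that
  \<open>vbr_vmul_left\<close> produces in the bracket terms.\<close>

lemma forms3_ext_d2:
  assumes \<tau>: "\<tau> \<in> forms2 M"
  shows "ext_d2 M \<tau> \<in> forms3 M"
proof (rule forms3I)
  show "ext_d2 M \<tau> X Y Z = 0" if "X \<notin> vfields M \<or> Y \<notin> vfields M \<or> Z \<notin> vfields M" for X Y Z
    using that by (auto simp: ext_d2_def)
next
  fix X Y Z assume X: "X \<in> vfields M" and Y: "Y \<in> vfields M" and Z: "Z \<in> vfields M"
  note lin = vfield_linear[OF X] vfield_linear[OF Y] vfield_linear[OF Z] form2_linear[OF \<tau>]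
  show "ext_d2 M \<tau> X Y Z \<in> Cinf M"
    using X Y Z \<tau> by (simp add: ext_d2_apply)
  show "ext_d2 M \<tau> (X + X') Y Z = ext_d2 M \<tau> X Y Z + ext_d2 M \<tau> X' Y Z" if "X' \<in> vfields M" for X'
    using X Y Z \<tau> that by (simp add: ext_d2_apply lin fun_eq_iff)
  show "ext_d2 M \<tau> (vmul f X) Y Z = f * ext_d2 M \<tau> X Y Z" if "f \<in> Cinf M" for f
    using X Y Z \<tau> that form2_skew[OF \<tau> X Y] form2_skew[OF \<tau> X Z]
    by (simp add: ext_d2_apply lin vbr_vmul_left fun_eq_iff algebra_simps)
  show "ext_d2 M \<tau> Y X Z = - ext_d2 M \<tau> X Y Z"
    using X Y Z \<tau> by (simp add: ext_d2_apply form2_skew[OF \<tau> X Y] lin vbr_skew[of Y X] fun_eq_iff)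
  show "ext_d2 M \<tau> X Z Y = - ext_d2 M \<tau> X Y Z"
    using X Y Z \<tau> by (simp add: ext_d2_apply form2_skew[OF \<tau> Y Z] lin vbr_skew[of Z Y] fun_eq_iff)
qed

text \<open>Iterated derivatives of values of \<open>\<tau>\<close> pair up into derivatives along
  brackets, nested brackets vanish by the Jacobi identity, and \<open>\<tau>\<close> on two brackets
  occurs in both orders with cancelling contributions. This yields closedness of
  \<open>\<omega> + ext_d2 M \<tau>\<close>.\<close>

lemma ext_d3_ext_d2:
  assumes \<tau>: "\<tau> \<in> forms2 M"
  shows "ext_d3 M (ext_d2 M \<tau>) = 0"
proof (intro ext)
  fix W X Y Z p
  show "ext_d3 M (ext_d2 M \<tau>) W X Y Z p = 0 W X Y Z p"
  proof (cases "W \<in> vfields M \<and> X \<in> vfields M \<and> Y \<in> vfields M \<and> Z \<in> vfields M")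
    case True
    then have W: "W \<in> vfields M" and X: "X \<in> vfields M" and Y: "Y \<in> vfields M" and Z: "Z \<in> vfields M"
      by auto
    show ?thesis
      using W X Y Z \<tau>
      by (simp add: ext_d3_def ext_d2_apply vfield_linear[OF W] vfield_linear[OF X] vfield_linear[OF Y]
          vfield_linear[OF Z] form2_linear[OF \<tau>] vbr_jacobi[OF W X Y] vbr_jacobi[OF W X Z]
          vbr_jacobi[OF W Y Z] vbr_jacobi[OF X Y Z] form2_skew[OF \<tau>, of "vbr W X" "vbr Y Z"]
          form2_skew[OF \<tau>, of "vbr W Y" "vbr X Z"] form2_skew[OF \<tau>, of "vbr W Z" "vbr X Y"])
  qed (auto simp: ext_d3_def)
qed

lemma ext_d3_add:
  assumes \<omega>: "\<omega> \<in> forms3 M" and \<eta>: "\<eta> \<in> forms3 M"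
  shows "ext_d3 M (\<omega> + \<eta>) = ext_d3 M \<omega> + ext_d3 M \<eta>"
proof (intro ext)
  fix W X Y Z p
  show "ext_d3 M (\<omega> + \<eta>) W X Y Z p = (ext_d3 M \<omega> + ext_d3 M \<eta>) W X Y Z p"
  proof (cases "W \<in> vfields M \<and> X \<in> vfields M \<and> Y \<in> vfields M \<and> Z \<in> vfields M")
    case True
    then have W: "W \<in> vfields M" and X: "X \<in> vfields M" and Y: "Y \<in> vfields M" and Z: "Z \<in> vfields M"
      by auto
    show ?thesis
      using W X Y Z \<omega> \<eta>
      by (simp add: ext_d3_def vfield_linear[OF W] vfield_linear[OF X] vfield_linear[OF Y]
          vfield_linear[OF Z])
  qed (auto simp: ext_d3_def)
qed

section \<open>The Lie 2-algebra of the Courant bracket\<close>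

definition courant_form :: "'a form3 \<Rightarrow> 'a vf \<Rightarrow> 'a form1 \<Rightarrow> 'a vf \<Rightarrow> 'a form1 \<Rightarrow> 'a form1" where
  "courant_form \<omega> u \<alpha> v \<beta> =
     lie_deriv1 M u \<beta> - lie_deriv1 M v \<alpha> - (1/2) *\<^sub>R ext_d0 M (\<beta> u - \<alpha> v) - \<omega> u v"

lemma courant_br_eq: "courant_br M \<omega> (u, \<alpha>) (v, \<beta>) = (vbr u v, courant_form \<omega> u \<alpha> v \<beta>)"
  by (simp add: courant_br_def courant_form_def)

lemma forms1_courant_form [simp]:
  "\<omega> \<in> forms3 M \<Longrightarrow> u \<in> vfields M \<Longrightarrow> v \<in> vfields M \<Longrightarrow> \<alpha> \<in> forms1 M \<Longrightarrow> \<beta> \<in> forms1 M \<Longrightarrow>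
    courant_form \<omega> u \<alpha> v \<beta> \<in> forms1 M"
  by (simp add: courant_form_def)

lemma courant_form_apply:
  assumes "\<omega> \<in> forms3 M" "u \<in> vfields M" "v \<in> vfields M" "\<alpha> \<in> forms1 M" "\<beta> \<in> forms1 M"
    and X: "X \<in> vfields M"
  shows "courant_form \<omega> u \<alpha> v \<beta> X = u (\<beta> X) - v (\<alpha> X) - \<beta> (vbr u X) + \<alpha> (vbr v X)
     - (1/2) *\<^sub>R (X (\<beta> u) - X (\<alpha> v)) - \<omega> u v X"
  using assms by (simp add: courant_form_def vfield_linear[OF X] fun_eq_iff)

text \<open>At fixed fields these rules sort the arguments of \<open>\<omega>\<close>, so that terms
  equal up to sign can be collected.\<close>

lemma form3_perms:
  assumes "\<omega> \<in> forms3 M" "X \<in> vfields M" "Y \<in> vfields M" "Z \<in> vfields M"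
  shows "\<omega> Y X Z = - \<omega> X Y Z" "\<omega> X Z Y = - \<omega> X Y Z" "\<omega> Z Y X = - \<omega> X Y Z"
    and "\<omega> Y Z X = \<omega> X Y Z" "\<omega> Z X Y = \<omega> X Y Z"
proof -
  have 1: "\<omega> B A C = - \<omega> A B C" if "A \<in> vfields M" "B \<in> vfields M" for A B C
    using form3_skew[OF assms(1) that] by simp
  have 2: "\<omega> A C B = - \<omega> A B C" if "B \<in> vfields M" "C \<in> vfields M" for A B C
    using form2_skew[OF form3_forms2[OF assms(1)] that] by simp
  show a: "\<omega> Y X Z = - \<omega> X Y Z" and b: "\<omega> X Z Y = - \<omega> X Y Z"
    using assms by (blast intro: 1 2)+
  show d: "\<omega> Y Z X = \<omega> X Y Z"
    using assms by (simp only: 2[of X Z Y] a minus_minus)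
  show "\<omega> Z Y X = - \<omega> X Y Z" "\<omega> Z X Y = \<omega> X Y Z"
    using assms by (simp_all only: 1[of Y Z X] 1[of X Z Y] b d minus_minus)
qed

text \<open>Closedness solved for one derivative, so that it can serve as a rewrite rule after the
  arguments have been sorted.\<close>

lemma closed_form3:
  assumes "ext_d3 M \<omega> = 0"
    and "W \<in> vfields M" "X \<in> vfields M" "Y \<in> vfields M" "Z \<in> vfields M"
  shows "W (\<omega> X Y Z) p = X (\<omega> W Y Z) p - Y (\<omega> W X Z) p + Z (\<omega> W X Y) p
    + \<omega> (vbr W X) Y Z p - \<omega> (vbr W Y) X Z p + \<omega> (vbr W Z) X Y p
    + \<omega> (vbr X Y) W Z p - \<omega> (vbr X Z) W Y p + \<omega> (vbr Y Z) W X p"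
proof -
  have "ext_d3 M \<omega> W X Y Z p = 0"
    by (simp add: assms(1))
  then show ?thesis
    using assms(2-) by (simp add: ext_d3_def)
qed

text \<open>In the cyclic sum of pairings every bracket term and the term
  \<open>\<omega> u v w\<close> occurs three times, and every derivative such as
  \<open>u (\<beta> w)\<close> with total weight \<open>1 + 1/2\<close>. The factor
  \<open>1/6\<close> turns these weights into \<open>1/2\<close> and \<open>1/4\<close>.\<close>

lemma jac_courant:
  assumes \<omega>: "\<omega> \<in> forms3 M"
    and u: "u \<in> vfields M" and v: "v \<in> vfields M" and w: "w \<in> vfields M"
    and \<alpha>: "\<alpha> \<in> forms1 M" and \<beta>: "\<beta> \<in> forms1 M" and \<gamma>: "\<gamma> \<in> forms1 M"
  shows "jac (L_courant M \<omega>) (u, \<alpha>) (v, \<beta>) (w, \<gamma>) =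
    (1/2) *\<^sub>R \<omega> u v w - (1/2) *\<^sub>R (\<gamma> (vbr u v) - \<beta> (vbr u w) + \<alpha> (vbr v w))
    - (1/4) *\<^sub>R (u (\<beta> w) - u (\<gamma> v) + v (\<gamma> u) - v (\<alpha> w) + w (\<alpha> v) - w (\<beta> u))"
  using assms
  by (simp add: L_courant_def pairing_def courant_br_eq courant_form_apply form3_perms[OF \<omega> u v w]
      vbr_skew[of v u] vbr_skew[of w u] vbr_skew[of w v]
      form1_linear[OF \<alpha>] form1_linear[OF \<beta>] form1_linear[OF \<gamma>] fun_eq_iff field_simps)

text \<open>The right side contains \<open>X (\<omega> u v w)\<close> with weight
  \<open>3/2\<close>, the left side with weight \<open>1/2\<close>. The difference of weight 1 is
  what completes the remaining \<open>\<omega>\<close> terms to the exterior derivative of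
  \<open>\<omega>\<close> at \<open>u\<close>, \<open>v\<close>, \<open>w\<close>, \<open>X\<close>,
  which is zero.\<close>

lemma courant_jacobiator:
  assumes \<omega>: "\<omega> \<in> forms3 M" and closed: "ext_d3 M \<omega> = 0"
    and u: "u \<in> vfields M" and v: "v \<in> vfields M" and w: "w \<in> vfields M"
    and \<alpha>: "\<alpha> \<in> forms1 M" and \<beta>: "\<beta> \<in> forms1 M" and \<gamma>: "\<gamma> \<in> forms1 M"
  shows "ext_d0 M (jac (L_courant M \<omega>) (u, \<alpha>) (v, \<beta>) (w, \<gamma>)) =
    courant_form \<omega> u \<alpha> (vbr v w) (courant_form \<omega> v \<beta> w \<gamma>) +
    courant_form \<omega> v \<beta> (vbr w u) (courant_form \<omega> w \<gamma> u \<alpha>) +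
    courant_form \<omega> w \<gamma> (vbr u v) (courant_form \<omega> u \<alpha> v \<beta>)"
proof (rule form1_eqI)
  fix X p assume X: "X \<in> vfields M"
  note lin = vfield_linear[OF u] vfield_linear[OF v] vfield_linear[OF w] vfield_linear[OF X]
    form1_linear[OF \<alpha>] form1_linear[OF \<beta>] form1_linear[OF \<gamma>] form3_linear[OF \<omega>]
  note skew = vbr_skew[of v u] vbr_skew[of w u] vbr_skew[of w v] form3_perms[OF \<omega> u v w]
    form3_perms[OF \<omega> u v X] form3_perms[OF \<omega> u w X] form3_perms[OF \<omega> v w X]
    form3_perms[OF \<omega>, of "vbr u v" w X] form3_perms[OF \<omega>, of "vbr u w" v X]
    form3_perms[OF \<omega>, of "vbr v w" u X] form3_perms[OF \<omega>, of "vbr u X" v w]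
    form3_perms[OF \<omega>, of "vbr v X" u w] form3_perms[OF \<omega>, of "vbr w X" u v]
    vbr_skew[of u "vbr A B" for A B] vbr_skew[of v "vbr A B" for A B] vbr_skew[of w "vbr A B" for A B]
  show "ext_d0 M (jac (L_courant M \<omega>) (u, \<alpha>) (v, \<beta>) (w, \<gamma>)) X p =
    (courant_form \<omega> u \<alpha> (vbr v w) (courant_form \<omega> v \<beta> w \<gamma>) +
    courant_form \<omega> v \<beta> (vbr w u) (courant_form \<omega> w \<gamma> u \<alpha>) +
    courant_form \<omega> w \<gamma> (vbr u v) (courant_form \<omega> u \<alpha> v \<beta>)) X p"
    \<comment> \<open>The first call evaluates both sides at \<open>X\<close>. The second
      distributes derivatives, moves nested brackets to the left slot where
      \<open>vbr_jacobi\<close> applies, and sorts arguments. Closedness then removes the derivative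
      along \<open>u\<close> before the real arithmetic.\<close>
    using assms X
    by (simp add: jac_courant courant_form_apply,
        simp add: lin skew vbr_jacobi[OF u v w] vbr_jacobi[OF u v X] vbr_jacobi[OF u w X]
          vbr_jacobi[OF v w X],
        simp add: closed_form3[OF closed u v w X] field_simps)
qed (use assms in \<open>simp_all add: jac_courant\<close>)

text \<open>The coherence axiom written in components. Derivatives of \<open>\<omega>\<close> enter
  with weight \<open>1/4\<close> from the mixed brackets and \<open>3/4\<close> from the
  Jacobiators, and each \<open>\<omega>\<close> term containing a bracket arises twice with weight
  \<open>1/2\<close>; together they form the exterior derivative of \<open>\<omega>\<close> at the
  four fields.\<close>

lemma courant_coherence:
  assumes \<omega>: "\<omega> \<in> forms3 M" and closed: "ext_d3 M \<omega> = 0"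
    and u: "u \<in> vfields M" and v: "v \<in> vfields M" and w: "w \<in> vfields M" and x: "x \<in> vfields M"
    and \<alpha>: "\<alpha> \<in> forms1 M" and \<beta>: "\<beta> \<in> forms1 M" and \<gamma>: "\<gamma> \<in> forms1 M" and \<delta>: "\<delta> \<in> forms1 M"
  shows "(1/2) *\<^sub>R u (jac (L_courant M \<omega>) (v, \<beta>) (w, \<gamma>) (x, \<delta>))
    - (1/2) *\<^sub>R v (jac (L_courant M \<omega>) (u, \<alpha>) (w, \<gamma>) (x, \<delta>))
    + (1/2) *\<^sub>R w (jac (L_courant M \<omega>) (u, \<alpha>) (v, \<beta>) (x, \<delta>))
    - (1/2) *\<^sub>R x (jac (L_courant M \<omega>) (u, \<alpha>) (v, \<beta>) (w, \<gamma>))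
    - jac (L_courant M \<omega>) (vbr u v, courant_form \<omega> u \<alpha> v \<beta>) (w, \<gamma>) (x, \<delta>)
    + jac (L_courant M \<omega>) (vbr u w, courant_form \<omega> u \<alpha> w \<gamma>) (v, \<beta>) (x, \<delta>)
    - jac (L_courant M \<omega>) (vbr u x, courant_form \<omega> u \<alpha> x \<delta>) (v, \<beta>) (w, \<gamma>)
    - jac (L_courant M \<omega>) (vbr v w, courant_form \<omega> v \<beta> w \<gamma>) (u, \<alpha>) (x, \<delta>)
    + jac (L_courant M \<omega>) (vbr v x, courant_form \<omega> v \<beta> x \<delta>) (u, \<alpha>) (w, \<gamma>)
    - jac (L_courant M \<omega>) (vbr w x, courant_form \<omega> w \<gamma> x \<delta>) (u, \<alpha>) (v, \<beta>) = 0" (is "?lhs = 0")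
proof
  fix p
  note lin = vfield_linear[OF u] vfield_linear[OF v] vfield_linear[OF w] vfield_linear[OF x]
    form1_linear[OF \<alpha>] form1_linear[OF \<beta>] form1_linear[OF \<gamma>] form1_linear[OF \<delta>] form3_linear[OF \<omega>]
  note skew = vbr_skew[of u "vbr A B" for A B] vbr_skew[of v "vbr A B" for A B]
    vbr_skew[of w "vbr A B" for A B] vbr_skew[of x "vbr A B" for A B]
    form3_perms[OF \<omega>, of "vbr u v" w x] form3_perms[OF \<omega>, of "vbr u w" v x]
    form3_perms[OF \<omega>, of "vbr v w" u x] form3_perms[OF \<omega>, of "vbr u x" v w]
    form3_perms[OF \<omega>, of "vbr v x" u w] form3_perms[OF \<omega>, of "vbr w x" u v]
    form3_perms[OF \<omega> u v w] form3_perms[OF \<omega> u v x] form3_perms[OF \<omega> u w x] form3_perms[OF \<omega> v w x]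
    vbr_skew[of v u] vbr_skew[of w u] vbr_skew[of w v]
    vbr_skew[of x u] vbr_skew[of x v] vbr_skew[of x w]
  show "?lhs p = 0 p"
    using assms
    by (simp add: jac_courant courant_form_apply,
        simp add: lin skew vbr_jacobi[OF u v w] vbr_jacobi[OF u v x] vbr_jacobi[OF u w x]
          vbr_jacobi[OF v w x],
        simp add: closed_form3[OF closed u v w x] field_simps)
qed

lemma lin_on_ext_d0: "lin_on (Cinf M) (forms1 M) (ext_d0 M)"
proof (rule lin_onI)
  show "ext_d0 M (f + g) = ext_d0 M f + ext_d0 M g" if "f \<in> Cinf M" "g \<in> Cinf M" for f g
    using that lin_onD(2)[OF lin_on_vfield] by (auto simp: ext_d0_def fun_eq_iff)
  show "ext_d0 M (c *\<^sub>R f) = c *\<^sub>R ext_d0 M f" if "f \<in> Cinf M" for c f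
    using that lin_onD(3)[OF lin_on_vfield] by (auto simp: ext_d0_def fun_eq_iff)
qed simp

lemma courant_form_skew:
  assumes \<omega>: "\<omega> \<in> forms3 M" and u: "u \<in> vfields M" and v: "v \<in> vfields M"
    and \<alpha>: "\<alpha> \<in> forms1 M" and \<beta>: "\<beta> \<in> forms1 M"
  shows "courant_form \<omega> v \<beta> u \<alpha> = - courant_form \<omega> u \<alpha> v \<beta>"
proof (rule form1_eqI)
  fix X p assume X: "X \<in> vfields M"
  show "courant_form \<omega> v \<beta> u \<alpha> X p = (- courant_form \<omega> u \<alpha> v \<beta>) X p"
    using assms X by (simp add: courant_form_apply form3_perms[OF \<omega> u v X] field_simps)
qed (use assms in simp_all)

lemma lin_on_courant_br:
  assumes \<omega>: "\<omega> \<in> forms3 M" and e: "e \<in> vfields M \<times> forms1 M"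
  shows "lin_on (vfields M \<times> forms1 M) (vfields M \<times> forms1 M) (courant_br M \<omega> e)"
proof -
  obtain u \<alpha> where e_eq: "e = (u, \<alpha>)" and u: "u \<in> vfields M" and \<alpha>: "\<alpha> \<in> forms1 M"
    using e by auto
  have "courant_form \<omega> u \<alpha> (v + w) (\<beta> + \<gamma>) = courant_form \<omega> u \<alpha> v \<beta> + courant_form \<omega> u \<alpha> w \<gamma>"
    if v: "v \<in> vfields M" and w: "w \<in> vfields M" and \<beta>: "\<beta> \<in> forms1 M" and \<gamma>: "\<gamma> \<in> forms1 M"
    for v w \<beta> \<gamma>
  proof (rule form1_eqI)
    fix X p assume X: "X \<in> vfields M"
    show "courant_form \<omega> u \<alpha> (v + w) (\<beta> + \<gamma>) X p
        = (courant_form \<omega> u \<alpha> v \<beta> + courant_form \<omega> u \<alpha> w \<gamma>) X p"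
      using that \<omega> u \<alpha> X
      by (simp add: courant_form_apply vfield_linear[OF u] vfield_linear[OF v] vfield_linear[OF w]
          vfield_linear[OF X] form1_linear[OF \<alpha>] form3_linear[OF \<omega>] field_simps)
  qed (use that \<omega> u \<alpha> in simp_all)
  moreover have "courant_form \<omega> u \<alpha> (c *\<^sub>R v) (c *\<^sub>R \<beta>) = c *\<^sub>R courant_form \<omega> u \<alpha> v \<beta>"
    if v: "v \<in> vfields M" and \<beta>: "\<beta> \<in> forms1 M" for c v \<beta>
  proof (rule form1_eqI)
    fix X p assume X: "X \<in> vfields M"
    show "courant_form \<omega> u \<alpha> (c *\<^sub>R v) (c *\<^sub>R \<beta>) X p = (c *\<^sub>R courant_form \<omega> u \<alpha> v \<beta>) X p"
      using that \<omega> u \<alpha> X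
      by (simp add: courant_form_apply vfield_linear[OF u] vfield_linear[OF v]
          vfield_linear[OF X] form1_linear[OF \<alpha>] form3_linear[OF \<omega>] field_simps)
  qed (use that \<omega> u \<alpha> in simp_all)
  ultimately show ?thesis
    unfolding e_eq using u \<alpha> \<omega> by (intro lin_onI) (auto simp: courant_br_eq)
qed

text \<open>With cyclic symmetry, linearity and vanishing on equal arguments need to be checked in
  only one position.\<close>

lemma jac_courant_cyclic: "jac (L_courant M \<omega>) e1 e2 e3 = jac (L_courant M \<omega>) e2 e3 e1"
  by (simp add: L_courant_def add.commute add.left_commute)

lemma lin_on_jac_courant:
  assumes \<omega>: "\<omega> \<in> forms3 M" and "e2 \<in> vfields M \<times> forms1 M" "e3 \<in> vfields M \<times> forms1 M"
  shows "lin_on (vfields M \<times> forms1 M) (Cinf M) (\<lambda>e. jac (L_courant M \<omega>) e e2 e3)"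
proof -
  obtain v \<beta> w \<gamma> where e_eq: "e2 = (v, \<beta>)" "e3 = (w, \<gamma>)"
    and v: "v \<in> vfields M" and \<beta>: "\<beta> \<in> forms1 M" and w: "w \<in> vfields M" and \<gamma>: "\<gamma> \<in> forms1 M"
    using assms by auto
  note lin = vfield_linear[OF v] vfield_linear[OF w] form1_linear[OF \<beta>] form1_linear[OF \<gamma>]
    form3_linear[OF \<omega>]
  show ?thesis
    unfolding e_eq
  proof (rule lin_onI)
    fix e assume "e \<in> vfields M \<times> forms1 M"
    then obtain u \<alpha> where e: "e = (u, \<alpha>)" and u: "u \<in> vfields M" and \<alpha>: "\<alpha> \<in> forms1 M"
      by auto
    note mem = \<omega> u v w \<alpha> \<beta> \<gamma>
    show "jac (L_courant M \<omega>) e (v, \<beta>) (w, \<gamma>) \<in> Cinf M"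
      unfolding e using mem by (simp add: jac_courant)
    show "jac (L_courant M \<omega>) (c *\<^sub>R e) (v, \<beta>) (w, \<gamma>) = c *\<^sub>R jac (L_courant M \<omega>) e (v, \<beta>) (w, \<gamma>)" for c
      unfolding e using mem by (simp add: jac_courant lin vfield_linear[OF u] fun_eq_iff field_simps)
    fix e' assume "e' \<in> vfields M \<times> forms1 M"
    then obtain u' \<alpha>' where e': "e' = (u', \<alpha>')" and u': "u' \<in> vfields M" and \<alpha>': "\<alpha>' \<in> forms1 M"
      by auto
    show "jac (L_courant M \<omega>) (e + e') (v, \<beta>) (w, \<gamma>)
        = jac (L_courant M \<omega>) e (v, \<beta>) (w, \<gamma>) + jac (L_courant M \<omega>) e' (v, \<beta>) (w, \<gamma>)"
      unfolding e e' using mem u' \<alpha>'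
      by (simp add: jac_courant lin vfield_linear[OF u] vfield_linear[OF u'] fun_eq_iff field_simps)
  qed
qed

lemma jac_courant_alt:
  assumes \<omega>: "\<omega> \<in> forms3 M" and "e \<in> vfields M \<times> forms1 M" "e' \<in> vfields M \<times> forms1 M"
  shows "jac (L_courant M \<omega>) e e e' = 0"
proof -
  obtain u \<alpha> v \<beta> where e: "e = (u, \<alpha>)" "e' = (v, \<beta>)"
    and u: "u \<in> vfields M" and \<alpha>: "\<alpha> \<in> forms1 M" and v: "v \<in> vfields M" and \<beta>: "\<beta> \<in> forms1 M"
    using assms by auto
  have "vbr u u = 0"
    by (simp add: fun_eq_iff)
  then show ?thesis
    unfolding e using \<omega> u v \<alpha> \<beta> by (simp add: jac_courant form3_self[OF \<omega>] form1_linear[OF \<beta>])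
qed

lemma L_courant_sel:
  "deg0 (L_courant M \<omega>) = vfields M \<times> forms1 M" "deg1 (L_courant M \<omega>) = Cinf M"
  "bd (L_courant M \<omega>) = (\<lambda>f. (0, ext_d0 M f))" "br (L_courant M \<omega>) = courant_br M \<omega>"
  "mbr (L_courant M \<omega>) (u, \<alpha>) f = (1/2) *\<^sub>R ext_d0 M f u"
  by (simp_all add: L_courant_def)

text \<open>The Lie derivative of the differential of \<open>f\<close> is the differential of
  \<open>u f\<close>, and the correction term of the Courant bracket removes half of it. This
  matches the factor \<open>1/2\<close> in the mixed bracket.\<close>

lemma courant_form_exact:
  assumes \<omega>: "\<omega> \<in> forms3 M" and u: "u \<in> vfields M" and \<alpha>: "\<alpha> \<in> forms1 M" and f: "f \<in> Cinf M"
  shows "courant_form \<omega> u \<alpha> 0 (ext_d0 M f) = ext_d0 M ((1/2) *\<^sub>R u f)"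
proof (rule form1_eqI)
  fix X p assume X: "X \<in> vfields M"
  show "courant_form \<omega> u \<alpha> 0 (ext_d0 M f) X p = ext_d0 M ((1/2) *\<^sub>R u f) X p"
    using assms X by (simp add: courant_form_apply vfield_linear[OF X] form1_linear[OF \<alpha>]
        form3_linear[OF \<omega>] field_simps)
qed (use assms in simp_all)

lemma vbr_jacobi_cyclic:
  assumes u: "u \<in> vfields M" and v: "v \<in> vfields M" and w: "w \<in> vfields M"
  shows "vbr u (vbr v w) + vbr v (vbr w u) + vbr w (vbr u v) = 0"
  using assms
  by (simp add: vbr_skew[of u "vbr A B" for A B] vbr_skew[of v "vbr A B" for A B]
      vbr_skew[of w "vbr A B" for A B] vbr_skew[of w u] vbr_jacobi[OF u v w])

theorem lie2_algebra_L_courant: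
  assumes \<omega>: "\<omega> \<in> forms3 M" and closed: "ext_d3 M \<omega> = 0"
  shows "lie2_algebra (L_courant M \<omega>)"
proof -
  let ?D = "vfields M \<times> forms1 M" and ?L = "L_courant M \<omega>"
  have D: "subspace ?D"
    by (rule subspace_Times[OF subspace_vfields subspace_forms1])
  have lin_bd: "lin_on (Cinf M) ?D (bd ?L)"
    unfolding L_courant_sel using lin_onD[OF lin_on_ext_d0] by (intro lin_onI) simp_all
  have skew: "br ?L e1 e2 = - br ?L e2 e1" if "e1 \<in> ?D" "e2 \<in> ?D" for e1 e2
  proof -
    obtain u \<alpha> v \<beta> where e: "e1 = (u, \<alpha>)" "e2 = (v, \<beta>)" and u: "u \<in> vfields M" and v: "v \<in> vfields M"
      and \<alpha>: "\<alpha> \<in> forms1 M" and \<beta>: "\<beta> \<in> forms1 M"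
      using \<open>e1 \<in> ?D\<close> \<open>e2 \<in> ?D\<close> by auto
    show ?thesis
      unfolding e by (simp add: L_courant_sel courant_br_eq courant_form_skew[OF \<omega> u v \<alpha> \<beta>] vbr_skew[of v u])
  qed
  have lin_br: "lin_on ?D ?D (br ?L e)" if "e \<in> ?D" for e
    unfolding L_courant_sel by (rule lin_on_courant_br[OF \<omega> that])
  have "lin_on ?D ?D (\<lambda>e'. br ?L e' e)" if e: "e \<in> ?D" for e
  proof (rule lin_onI)
    note lin = lin_onD[OF lin_br[OF e]]
    show "br ?L e' e \<in> ?D" if "e' \<in> ?D" for e'
      unfolding skew[OF that e] by (rule subspace_neg[OF D lin(1)[OF that]])
    show "br ?L (e1 + e2) e = br ?L e1 e + br ?L e2 e" if "e1 \<in> ?D" "e2 \<in> ?D" for e1 e2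
      unfolding skew[OF that(1) e] skew[OF that(2) e] skew[OF subspace_add[OF D that] e] lin(2)[OF that]
      by simp
    show "br ?L (c *\<^sub>R e') e = c *\<^sub>R br ?L e' e" if "e' \<in> ?D" for c e'
      unfolding skew[OF that e] skew[OF subspace_scale[OF D that] e] lin(3)[OF that] by simp
  qed
  then have bilin_br: "bilin_on ?D ?D ?D (br ?L)"
    using lin_br unfolding bilin_on_def by blast
  have "lin_on (Cinf M) (Cinf M) (mbr ?L e)" if "e \<in> ?D" for e
  proof -
    obtain u \<alpha> where e: "e = (u, \<alpha>)" and u: "u \<in> vfields M"
      using \<open>e \<in> ?D\<close> by auto
    show ?thesis
      unfolding e by (rule lin_onI) (use u in \<open>simp_all add: L_courant_sel vfield_linear[OF u] fun_eq_iff algebra_simps\<close>)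
  qed
  moreover have "lin_on ?D (Cinf M) (\<lambda>e. mbr ?L e f)" if f: "f \<in> Cinf M" for f
  proof (rule lin_onI)
    fix e assume "e \<in> ?D"
    then obtain u \<alpha> where e: "e = (u, \<alpha>)" and u: "u \<in> vfields M"
      by auto
    show "mbr ?L e f \<in> Cinf M"
      unfolding e using u f by (simp add: L_courant_sel)
    show "mbr ?L (c *\<^sub>R e) f = c *\<^sub>R mbr ?L e f" for c
      unfolding e using u f by (simp add: L_courant_sel fun_eq_iff)
    fix e' assume "e' \<in> ?D"
    then obtain v \<beta> where e': "e' = (v, \<beta>)" and v: "v \<in> vfields M"
      by auto
    show "mbr ?L (e + e') f = mbr ?L e f + mbr ?L e' f"
      unfolding e e' using u v f by (simp add: L_courant_sel fun_eq_iff algebra_simps)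
  qed
  ultimately have bilin_mbr: "bilin_on ?D (Cinf M) (Cinf M) (mbr ?L)"
    unfolding bilin_on_def by blast
  have jac1: "lin_on ?D (Cinf M) (\<lambda>e. jac ?L e e2 e3)" if "e2 \<in> ?D" "e3 \<in> ?D" for e2 e3
    by (rule lin_on_jac_courant[OF \<omega> that])
  have jac2: "lin_on ?D (Cinf M) (\<lambda>e. jac ?L e1 e e3)" if "e1 \<in> ?D" "e3 \<in> ?D" for e1 e3
    unfolding jac_courant_cyclic[of \<omega> e1] by (rule jac1[OF that(2,1)])
  have jac3: "lin_on ?D (Cinf M) (\<lambda>e. jac ?L e1 e2 e)" if "e1 \<in> ?D" "e2 \<in> ?D" for e1 e2
    unfolding jac_courant_cyclic[of \<omega> e1 e2] by (rule jac2[OF that(2,1)])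
  have bilin_jac: "bilin_on ?D ?D (Cinf M) (jac ?L e)" if "e \<in> ?D" for e
    unfolding bilin_on_def using that by (intro conjI ballI jac2 jac3)
  have alt: "jac ?L e e e' = 0" "jac ?L e e' e' = 0" "jac ?L e e' e = 0" if "e \<in> ?D" "e' \<in> ?D" for e e'
    using jac_courant_alt[OF \<omega> that] jac_courant_alt[OF \<omega> that(2,1)]
      jac_courant_cyclic[of \<omega> e e' e'] jac_courant_cyclic[of \<omega> e' e e] jac_courant_cyclic[of \<omega> e e e']
    by metis+
  have bd_mbr: "bd ?L (mbr ?L e f) = br ?L e (bd ?L f)" if "e \<in> ?D" and f: "f \<in> Cinf M" for e f
  proof -
    obtain u \<alpha> where e: "e = (u, \<alpha>)" and u: "u \<in> vfields M" and \<alpha>: "\<alpha> \<in> forms1 M"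
      using \<open>e \<in> ?D\<close> by auto
    show ?thesis
      unfolding e using u by (simp add: L_courant_sel courant_br_eq courant_form_exact[OF \<omega> u \<alpha> f])
  qed
  \<comment> \<open>Both sides vanish, since a boundary has zero vector field component.\<close>
  have mbr_bd: "mbr ?L (bd ?L f) g = - mbr ?L (bd ?L g) f" for f g
    by (simp add: L_courant_sel fun_eq_iff)
  have jacobiator: "bd ?L (jac ?L e1 e2 e3)
      = br ?L e1 (br ?L e2 e3) + br ?L e2 (br ?L e3 e1) + br ?L e3 (br ?L e1 e2)"
    if mem: "e1 \<in> ?D" "e2 \<in> ?D" "e3 \<in> ?D" for e1 e2 e3
  proof -
    obtain u \<alpha> v \<beta> w \<gamma> where e: "e1 = (u, \<alpha>)" "e2 = (v, \<beta>)" "e3 = (w, \<gamma>)"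
      and u: "u \<in> vfields M" and v: "v \<in> vfields M" and w: "w \<in> vfields M"
      and \<alpha>: "\<alpha> \<in> forms1 M" and \<beta>: "\<beta> \<in> forms1 M" and \<gamma>: "\<gamma> \<in> forms1 M"
      using mem by auto
    show ?thesis
      unfolding e L_courant_sel courant_br_eq courant_jacobiator[OF \<omega> closed u v w \<alpha> \<beta> \<gamma>]
      by (simp add: vbr_jacobi_cyclic[OF u v w])
  qed
  \<comment> \<open>Both sides come to \<open>-1/4\<close> times \<open>vbr u v f\<close>: on the
    left as \<open>-1/2 + 1/4\<close> from the bracket and derivative terms of
    \<open>jac_courant\<close>, on the right as \<open>1/4 - 1/2\<close>.\<close>
  have jac_bd: "jac ?L e1 e2 (bd ?L f)
      = mbr ?L e1 (mbr ?L e2 f) + mbr ?L e2 (- mbr ?L e1 f) + (- mbr ?L (br ?L e1 e2) f)"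
    if mem: "e1 \<in> ?D" "e2 \<in> ?D" and f: "f \<in> Cinf M" for e1 e2 f
  proof -
    obtain u \<alpha> v \<beta> where e: "e1 = (u, \<alpha>)" "e2 = (v, \<beta>)" and u: "u \<in> vfields M" and v: "v \<in> vfields M"
      and \<alpha>: "\<alpha> \<in> forms1 M" and \<beta>: "\<beta> \<in> forms1 M"
      using mem by auto
    show ?thesis
      unfolding e using u v \<alpha> \<beta> f \<omega>
      by (simp add: L_courant_sel courant_br_eq jac_courant vfield_linear[OF u] vfield_linear[OF v]
          form1_linear[OF \<alpha>] form1_linear[OF \<beta>] form3_linear[OF \<omega>] fun_eq_iff field_simps)
  qed
  have coherence: "mbr ?L e1 (jac ?L e2 e3 e4) - mbr ?L e2 (jac ?L e1 e3 e4) + mbr ?L e3 (jac ?L e1 e2 e4)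
      - mbr ?L e4 (jac ?L e1 e2 e3) - jac ?L (br ?L e1 e2) e3 e4 + jac ?L (br ?L e1 e3) e2 e4
      - jac ?L (br ?L e1 e4) e2 e3 - jac ?L (br ?L e2 e3) e1 e4 + jac ?L (br ?L e2 e4) e1 e3
      - jac ?L (br ?L e3 e4) e1 e2 = 0"
    if mem: "e1 \<in> ?D" "e2 \<in> ?D" "e3 \<in> ?D" "e4 \<in> ?D" for e1 e2 e3 e4
  proof -
    obtain u \<alpha> v \<beta> w \<gamma> x \<delta> where e: "e1 = (u, \<alpha>)" "e2 = (v, \<beta>)" "e3 = (w, \<gamma>)" "e4 = (x, \<delta>)"
      and u: "u \<in> vfields M" and v: "v \<in> vfields M" and w: "w \<in> vfields M" and x: "x \<in> vfields M"
      and \<alpha>: "\<alpha> \<in> forms1 M" and \<beta>: "\<beta> \<in> forms1 M" and \<gamma>: "\<gamma> \<in> forms1 M" and \<delta>: "\<delta> \<in> forms1 M"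
      using mem by auto
    show ?thesis
      unfolding e L_courant_sel courant_br_eq ext_d0_apply[OF u] ext_d0_apply[OF v]
        ext_d0_apply[OF w] ext_d0_apply[OF x]
      by (rule courant_coherence[OF \<omega> closed u v w x \<alpha> \<beta> \<gamma> \<delta>])
  qed
  show ?thesis
    unfolding lie2_algebra_def L_courant_sel(1,2)
    by (intro conjI ballI D subspace_Cinf lin_bd bilin_br skew bilin_mbr bilin_jac jac1 alt bd_mbr
        mbr_bd jacobiator jac_bd coherence)
qed

section \<open>The gauge transformation by a 2-form\<close>

text \<open>Cartan calculus: the Lie derivatives of \<open>\<tau> v\<close> and
  \<open>\<tau> u\<close>, together with the differential of \<open>\<tau> u v\<close>, produce
  \<open>\<tau> (vbr u v)\<close> plus a contraction of the exterior derivative of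
  \<open>\<tau>\<close>. The additional twist cancels that contraction. Skew-symmetry doubles the
  pairing difference, so the factor \<open>1/2\<close> in the bracket gives the differential its
  required weight 1.\<close>

lemma courant_form_gauge:
  assumes \<omega>: "\<omega> \<in> forms3 M" and \<tau>: "\<tau> \<in> forms2 M"
    and u: "u \<in> vfields M" and v: "v \<in> vfields M" and \<alpha>: "\<alpha> \<in> forms1 M" and \<beta>: "\<beta> \<in> forms1 M"
  shows "courant_form (\<omega> + ext_d2 M \<tau>) u (\<alpha> + \<tau> u) v (\<beta> + \<tau> v) =
    courant_form \<omega> u \<alpha> v \<beta> + \<tau> (vbr u v)"
proof (rule form1_eqI)
  have \<omega>\<tau>: "\<omega> + ext_d2 M \<tau> \<in> forms3 M"
    by (rule forms3_add[OF \<omega> forms3_ext_d2[OF \<tau>]])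
  show "courant_form (\<omega> + ext_d2 M \<tau>) u (\<alpha> + \<tau> u) v (\<beta> + \<tau> v) \<in> forms1 M"
    "courant_form \<omega> u \<alpha> v \<beta> + \<tau> (vbr u v) \<in> forms1 M"
    using assms \<omega>\<tau> by simp_all
  fix X p assume X: "X \<in> vfields M"
  show "courant_form (\<omega> + ext_d2 M \<tau>) u (\<alpha> + \<tau> u) v (\<beta> + \<tau> v) X p =
    (courant_form \<omega> u \<alpha> v \<beta> + \<tau> (vbr u v)) X p"
    using assms X \<omega>\<tau>
    by (simp add: courant_form_apply ext_d2_apply form2_skew[OF \<tau> u v] vfield_linear[OF u]
        vfield_linear[OF v] vfield_linear[OF X] form2_skew[OF \<tau>, of "vbr u X" v]
        form2_skew[OF \<tau>, of "vbr v X" u] field_simps)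
qed

text \<open>The Jacobiator is built from the bracket and the pairing alone, so it is preserved once
  both of these are.\<close>

theorem lie2_morphism_T_iso:
  assumes \<omega>: "\<omega> \<in> forms3 M" and closed: "ext_d3 M \<omega> = 0" and \<tau>: "\<tau> \<in> forms2 M"
  shows "lie2_morphism (L_courant M \<omega>) (L_courant M (\<omega> + ext_d2 M \<tau>)) (T_iso \<tau>)"
proof -
  let ?D = "vfields M \<times> forms1 M" and ?L = "L_courant M \<omega>" and ?L' = "L_courant M (\<omega> + ext_d2 M \<tau>)"
  let ?T = "\<lambda>(u, \<alpha>). (u, \<alpha> + \<tau> u)"
  have \<omega>\<tau>: "\<omega> + ext_d2 M \<tau> \<in> forms3 M"
    by (rule forms3_add[OF \<omega> forms3_ext_d2[OF \<tau>]])
  have "ext_d3 M (\<omega> + ext_d2 M \<tau>) = 0"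
    by (simp add: ext_d3_add[OF \<omega> forms3_ext_d2[OF \<tau>]] closed ext_d3_ext_d2[OF \<tau>])
  then have alg: "lie2_algebra ?L" "lie2_algebra ?L'"
    using lie2_algebra_L_courant \<omega> closed \<omega>\<tau> by blast+
  have "lin_on ?D ?D ?T"
    by (rule lin_onI) (use \<tau> in \<open>auto simp: form2_linear[OF \<tau>] algebra_simps\<close>)
  moreover have "bd ?L' f = ?T (bd ?L f)" for f
    by (simp add: L_courant_sel form2_linear[OF \<tau>])
  moreover have T_br: "br ?L' (?T e1) (?T e2) = ?T (br ?L e1 e2)" if "e1 \<in> ?D" "e2 \<in> ?D" for e1 e2
    using that courant_form_gauge[OF \<omega> \<tau>] by (auto simp: L_courant_sel courant_br_eq)
  moreover have "mbr ?L' (?T e) f = mbr ?L e f" for e f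
    by (cases e) (simp add: L_courant_sel)
  moreover have "jac ?L' (?T e1) (?T e2) (?T e3) = jac ?L e1 e2 e3"
    if "e1 \<in> ?D" "e2 \<in> ?D" "e3 \<in> ?D" for e1 e2 e3
  proof -
    \<comment> \<open>The two contributions \<open>\<tau> v u\<close> and \<open>\<tau> u v\<close>
      cancel.\<close>
    have pair: "pairing (?T e) (?T e') = pairing e e'" if mem: "e \<in> ?D" "e' \<in> ?D" for e e'
    proof -
      obtain u \<alpha> v \<beta> where e: "e = (u, \<alpha>)" "e' = (v, \<beta>)" "u \<in> vfields M" "v \<in> vfields M"
        using mem by auto
      show ?thesis
        using form2_skew[OF \<tau> e(3,4)] by (simp add: e(1,2) pairing_def fun_eq_iff)
    qed
    have jac: "jac (L_courant M \<eta>) e1 e2 e3 = - (1/6) *\<^sub>R (pairing (br (L_courant M \<eta>) e1 e2) e3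
        + pairing (br (L_courant M \<eta>) e2 e3) e1 + pairing (br (L_courant M \<eta>) e3 e1) e2)" for \<eta> e1 e2 e3
      by (simp add: L_courant_def)
    have br: "br ?L e e' \<in> ?D" if "e \<in> ?D" "e' \<in> ?D" for e e'
      using lie2_algebraD(4)[OF alg(1)] that by (simp add: L_courant_sel(1))
    show ?thesis
      unfolding jac T_br[OF that(1,2)] T_br[OF that(2,3)] T_br[OF that(3,1)]
        pair[OF br[OF that(1,2)] that(3)] pair[OF br[OF that(2,3)] that(1)] pair[OF br[OF that(3,1)] that(2)] ..
  qed
  ultimately show ?thesis
    unfolding T_iso_def
    by (intro lie2_morphism_strictI alg) (simp_all only: L_courant_sel(1,2) lin_on_id)
qed

section \<open>Rogers' embedding\<close>

text \<open>On pairs satisfying the Hamiltonian condition, the two brackets differ by an exact form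
  whose potential is the second component of the embedding.\<close>

theorem lie2_morphism_rogers:
  assumes \<omega>: "\<omega> \<in> forms3 M" and closed: "ext_d3 M \<omega> = 0" and alg: "lie2_algebra (L_form M \<omega>)"
  shows "lie2_morphism (L_form M \<omega>) (L_courant M \<omega>) rogers"
proof -
  let ?D = "vfields M \<times> forms1 M" and ?F = "L_form M \<omega>" and ?L = "L_courant M \<omega>"
  let ?r = "mor2 (rogers :: 'a lie2_endo)"
  have sel: "deg1 ?F = Cinf M" "bd ?F = (\<lambda>f. (0, ext_d0 M f))" "mbr ?F e f = 0"
    "br ?F (x, \<beta>) (z, \<phi>) = (vbr x z, \<omega> x z)" "jac ?F (x, \<beta>) (z, \<phi>) (y, \<psi>) = - \<omega> x z y"
    "?r (x, \<beta>) (z, \<phi>) = (1/2) *\<^sub>R (\<phi> x - \<beta> z)"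
    for e x \<beta> z \<phi> y \<psi> f
    by (simp_all add: L_form_def rogers_def)
  have D: "x \<in> vfields M" "\<beta> \<in> forms1 M" "\<omega> x = - ext_d1 M \<beta>" if "(x, \<beta>) \<in> deg0 ?F" for x \<beta>
    using that by (simp_all add: L_form_def)
  have D_sub: "deg0 ?F \<subseteq> ?D"
    using D by auto
  have skew: "?r e1 e2 = - ?r e2 e1" for e1 e2
    by (cases e1; cases e2) (simp add: sel fun_eq_iff field_simps)
  have lin: "lin_on (deg0 ?F) (Cinf M) (?r e)" if mem: "e \<in> deg0 ?F" for e
  proof -
    obtain x \<beta> where e: "e = (x, \<beta>)" and x: "x \<in> vfields M" and \<beta>: "\<beta> \<in> forms1 M"
      using D_sub mem by auto
    have "lin_on ?D (Cinf M) (?r e)"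
      unfolding e
      by (rule lin_onI) (use x \<beta> in \<open>auto simp: sel form1_linear[OF \<beta>] fun_eq_iff field_simps\<close>)
    then show ?thesis
      by (rule lin_on_subset[OF D_sub])
  qed
  have "lin_on (deg0 ?F) (Cinf M) (\<lambda>e'. ?r e' e)" if "e \<in> deg0 ?F" for e
    unfolding skew[of _ e] by (rule lin_on_uminus[OF subspace_Cinf lin[OF that]])
  then have bilin: "bilin_on (deg0 ?F) (deg0 ?F) (Cinf M) ?r"
    using lin unfolding bilin_on_def by blast
  have bd: "bd ?L (?r e1 e2) = br ?L e1 e2 - br ?F e1 e2" if "e1 \<in> deg0 ?F" "e2 \<in> deg0 ?F" for e1 e2
  proof -
    obtain x \<beta> z \<phi> where e: "e1 = (x, \<beta>)" "e2 = (z, \<phi>)"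
      by fastforce
    note x = D[OF that(1)[unfolded e]] and z = D[OF that(2)[unfolded e]]
    have "ext_d0 M ((1/2) *\<^sub>R (\<phi> x - \<beta> z)) = courant_form \<omega> x \<beta> z \<phi> - \<omega> x z"
    proof (rule form1_eqI)
      fix X p assume X: "X \<in> vfields M"
      \<comment> \<open>The Hamiltonian condition for both pairs is solved for
        \<open>z (\<beta> X)\<close> and \<open>x (\<phi> X)\<close>. Substituted into the Courant
        bracket, these give three copies of \<open>\<omega> x z X\<close> with signs plus, plus,
        minus; the remaining one is the bracket of \<open>L_form\<close>.\<close>
      have "\<omega> x z X p = - ext_d1 M \<beta> z X p" "\<omega> z x X p = - ext_d1 M \<phi> x X p"
        by (simp_all add: x(3) z(3))
      moreover have "\<omega> z x X p = - \<omega> x z X p"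
        by (simp add: form3_skew[OF \<omega> x(1) z(1)])
      ultimately have "z (\<beta> X) p = X (\<beta> z) p + \<beta> (vbr z X) p - \<omega> x z X p"
        "x (\<phi> X) p = X (\<phi> x) p + \<phi> (vbr x X) p + \<omega> x z X p"
        using x(1) z(1) X by (simp_all add: ext_d1_def)
      then show "ext_d0 M ((1/2) *\<^sub>R (\<phi> x - \<beta> z)) X p = (courant_form \<omega> x \<beta> z \<phi> - \<omega> x z) X p"
        using x(1,2) z(1,2) X \<omega> by (simp add: courant_form_apply vfield_linear[OF X] field_simps)
    qed (use x(1,2) z(1,2) \<omega> in simp_all)
    then show ?thesis
      unfolding e by (simp add: sel L_courant_sel courant_br_eq)
  qed
  have mixed: "?r e (bd ?F f) = mbr ?L e f - mbr ?F e f" if "e \<in> deg0 ?F" and f: "f \<in> Cinf M" for e f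
  proof -
    obtain x \<beta> where e: "e = (x, \<beta>)" and x: "x \<in> vfields M" and \<beta>: "\<beta> \<in> forms1 M"
      using D_sub \<open>e \<in> deg0 ?F\<close> by auto
    show ?thesis
      unfolding e using x f by (simp add: sel L_courant_sel form1_linear[OF \<beta>] fun_eq_iff)
  qed
  have jac: "jac ?L e1 e2 e3 - jac ?F e1 e2 e3 = (mbr ?L e1 (?r e2 e3) + ?r e1 (br ?F e2 e3)) +
      (mbr ?L e2 (?r e3 e1) + ?r e2 (br ?F e3 e1)) + (mbr ?L e3 (?r e1 e2) + ?r e3 (br ?F e1 e2))"
    if mem: "e1 \<in> deg0 ?F" "e2 \<in> deg0 ?F" "e3 \<in> deg0 ?F" for e1 e2 e3
  proof -
    obtain x \<alpha> y \<beta> z \<gamma> where e: "e1 = (x, \<alpha>)" "e2 = (y, \<beta>)" "e3 = (z, \<gamma>)"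
      and x: "x \<in> vfields M" and y: "y \<in> vfields M" and z: "z \<in> vfields M"
      and \<alpha>: "\<alpha> \<in> forms1 M" and \<beta>: "\<beta> \<in> forms1 M" and \<gamma>: "\<gamma> \<in> forms1 M"
      using subsetD[OF D_sub] mem by (metis SigmaE)
    \<comment> \<open>On the left the \<open>\<omega>\<close> terms have weight \<open>1/2\<close>
      from the Courant Jacobiator and 1 from that of \<open>L_form\<close>. On the right each of the
      three terms of \<open>?r\<close> on a bracket contributes \<open>1/2\<close>.\<close>
    show ?thesis
      unfolding e using \<omega> x y z \<alpha> \<beta> \<gamma>
      by (simp add: sel L_courant_sel jac_courant form3_perms[OF \<omega> x y z] vbr_skew[of z x]
          vfield_linear[OF x] vfield_linear[OF y] vfield_linear[OF z]
          form1_linear[OF \<alpha>] form1_linear[OF \<beta>] form1_linear[OF \<gamma>] fun_eq_iff field_simps)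
  qed
  have lin0: "lin_on (deg0 ?F) ?D (\<lambda>e. e)"
    by (rule lin_on_subset[OF D_sub lin_on_id])
  have bd1: "bd ?L f = bd ?F f" for f
    by (simp add: sel L_courant_sel)
  have rogers01: "mor0 (rogers :: 'a lie2_endo) = (\<lambda>e. e)" "mor1 (rogers :: 'a lie2_endo) = (\<lambda>f. f)"
    by (simp_all add: rogers_def)
  show ?thesis
    unfolding lie2_morphism_def rogers01 sel(1) L_courant_sel(1,2)
    by (intro conjI ballI alg lie2_algebra_L_courant[OF \<omega> closed] lin0 lin_on_id bd1 bilin skew bd
        mixed jac)
qed

end

section \<open>Comparison of the two compositions\<close>

theorem mainTheorem7:
  fixes M :: "'m manifold" and \<omega> :: "'m form3" and \<tau> :: "'m form2"
    and G :: "'g monoid" and N :: "'g manifold" and act :: "'g \<Rightarrow> 'm \<Rightarrow> 'm"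
    and J :: "('g, 'm) moment_data"
    and \<P> :: "('p, 'x, 'm) gerbe" and \<gamma> :: "'p form1" and B :: "'x form2"
  assumes "is_manifold M"
    and "\<omega> \<in> forms3 M" and "ext_d3 M \<omega> = 0"
    and "lie_group G N" and "connected_space (mtop N)"
    and "smooth_action G N M act"
    and "\<forall>g\<in>carrier G. pullback3 M M (act g) \<omega> = \<omega>"
    and "homotopy_moment_map G N M act \<omega> J"
    and "\<tau> \<in> forms2 M" and "\<forall>g\<in>carrier G. pullback2 M M (act g) \<tau> = \<tau>"
    and "bundle_gerbe M \<P>" and "gerbe_connection \<P> \<gamma>"
    and "gerbe_curving \<P> \<gamma> B" and "three_curvature M \<P> B \<omega>"
  shows "two_isomorphic (lie_alg G N) (L_courant M (\<omega> + ext_d2 M \<tau>))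
           (lie2_comp (T_iso \<tau>) (lie2_comp rogers J))
           (lie2_comp rogers (induced_moment G N M act \<tau> J))"
proof -
  interpret smooth_manifold M
    by unfold_locales (rule assms(1))
  note \<omega> = assms(2) and closed = assms(3) and J = assms(8) and \<tau> = assms(9)
  have mor: "lie2_morphism (lie_alg G N) (L_form M \<omega>) J"
    and J0: "\<And>\<xi>. \<xi> \<in> left_inv_vfields G N \<Longrightarrow> fst (mor0 J \<xi>) = gen_field G N M act \<xi>"
    using J by (simp_all add: homotopy_moment_map_def)
  note alg = lie2_morphismD(2)[OF mor]
  have deg0: "deg0 (lie_alg G N) = left_inv_vfields G N"
    by (simp add: lie_alg_def lie2_of_lie_algebra_def)
  have J0_eq: "mor0 J \<xi> = (gen_field G N M act \<xi>, snd (mor0 J \<xi>))" if "\<xi> \<in> left_inv_vfields G N" for \<xi>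
    using J0[OF that] by (simp add: prod_eq_iff)
  \<comment> \<open>The generating field is the first component of an element of degree 0 of
    \<open>L_form M \<omega>\<close>, so it is a smooth derivation by membership. The skew-symmetry
    of \<open>\<tau>\<close> can then be applied to it.\<close>
  have vf: "gen_field G N M act \<xi> \<in> vfields M" if "\<xi> \<in> left_inv_vfields G N" for \<xi>
    using lin_onD(1)[OF lie2_morphismD(3)[OF mor], of \<xi>] J0[OF that] that
    by (auto simp: deg0 L_form_def)
  show ?thesis
  proof (rule two_isomorphic_if_eq_on)
    show "lie2_morphism (lie_alg G N) (L_courant M (\<omega> + ext_d2 M \<tau>))
        (lie2_comp (T_iso \<tau>) (lie2_comp rogers J))"
      by (rule lie2_morphism_comp[OF lie2_morphism_comp[OF mor lie2_morphism_rogers[OF \<omega> closed alg]]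
            lie2_morphism_T_iso[OF \<omega> closed \<tau>]])
  next
    fix \<xi> assume "\<xi> \<in> deg0 (lie_alg G N)"
    then have \<xi>: "\<xi> \<in> left_inv_vfields G N"
      by (simp add: deg0)
    obtain \<beta> where \<beta>: "mor0 J \<xi> = (gen_field G N M act \<xi>, \<beta>)"
      using J0_eq \<xi> by blast
    show "mor0 (lie2_comp rogers (induced_moment G N M act \<tau> J)) \<xi> =
        mor0 (lie2_comp (T_iso \<tau>) (lie2_comp rogers J)) \<xi>"
      by (simp add: lie2_comp_def rogers_def induced_moment_def T_iso_def \<beta>)
    fix \<zeta> assume "\<zeta> \<in> deg0 (lie_alg G N)"
    then have \<zeta>: "\<zeta> \<in> left_inv_vfields G N"
      by (simp add: deg0)
    obtain \<phi> where \<phi>: "mor0 J \<zeta> = (gen_field G N M act \<zeta>, \<phi>)"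
      using J0_eq \<zeta> by blast
    show "mor2 (lie2_comp rogers (induced_moment G N M act \<tau> J)) \<xi> \<zeta> =
        mor2 (lie2_comp (T_iso \<tau>) (lie2_comp rogers J)) \<xi> \<zeta>"
      using form2_skew[OF \<tau> vf[OF \<xi>] vf[OF \<zeta>]]
      by (simp add: lie2_comp_def rogers_def induced_moment_def T_iso_def \<beta> \<phi> fun_eq_iff field_simps)
  qed (simp add: lie2_comp_def rogers_def induced_moment_def T_iso_def)
qed

end
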